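(* Let $0\leq n\leq m\leq\omega$. Then the surjection from $\mathcal{M}_n$ onto $\mathcal{M}_m$ induced by the identity map on $\mathcal{P}(\omega^\omega)$ (sending the $n$-degree of $\mathcal{A}$ to the $m$-degree of $\mathcal{A}$) preserves $0$, $1$, $\oplus$ and $\otimes$. It does not necessarily preserve $\to$: there are $0\leq n\leq m\leq\omega$ for which this surjection does not preserve $\to$.
   Context: A mass problem is a subset of $\omega^\omega$. $\Phi_e$ is the Turing functional with index $e$; writing $\Phi_e(f)\in\mathcal{A}$ means in particular that $\Phi_e(f)$ is total. $\Pi^0_n$-classes are the effective (lightface) $\Pi^0_n$ subsets of $\omega^\omega$; a sequence of classes is uniformly $\Pi^0_n$ if it has a computable sequence of $\Pi^0_n$-indices. For $n=0$, $\Pi^0_0$-classes are finite Boolean combinations of cylinders $\{f \mid \sigma\subset f\}$, $\sigma\in\omega^{<\omega}$. For $n\in\omega$ and $\mathcal{A},\mathcal{B}\subseteq\omega^\omega$, $\mathcal{A}\leq_n\mathcal{B}$ means: there are a uniformly $\Pi^0_n$ sequence $\mathcal{V}_0,\mathcal{V}_1,\dots$ with $\mathcal{B}\subseteq\bigcup_i\mathcal{V}_i$ and a computable sequence $e_0,e_1,\dots$ such that for every $i$ and every $f\in\mathcal{B}\cap\mathcal{V}_i$ we have $\Phi_{e_i}(f)\in\mathcal{A}$. $\leq_\omega$ denotes Muchnik reducibility: $\mathcal{A}\leq_\omega\mathcal{B}$ iff every $f\in\mathcal{B}$ computes some $g\in\mathcal{A}$. For $n\in\omega+1$, $\equiv_n$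 is the induced equivalence and $\mathcal{M}_n=\mathcal{P}(\omega^\omega)/{\equiv_n}$, ordered by $\leq_n$. Each $\mathcal{M}_n$ is a Brouwer algebra, i.e. a bounded distributive lattice with join $\oplus$, meet $\otimes$ and an operation $\to$ such that $a\oplus c\geq b$ iff $c\geq a\to b$. Here $0$ and $1$ are the least and greatest element (the degrees of $\omega^\omega$ and of $\emptyset$), and joins and meets are induced by $\mathcal{A}\oplus\mathcal{B}=\{f\oplus g\mid f\in\mathcal{A},g\in\mathcal{B}\}$ and $\mathcal{A}\otimes\mathcal{B}=\{0^\frown f \mid f\in\mathcal{A}\}\cup\{1^\frown g\mid g\in\mathcal{B}\}$. *)

theory Defs
  imports Main "HOL-Library.Nat_Bijection" "HOL-Library.Extended_Nat"
begin

section \<open>Turing functionals\<close>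

text \<open>
  Oracle programs compute partial functions from \<open>nat\<close> to \<open>nat\<close>; several arguments
  are passed through the Cantor pairing \<^const>\<open>prod_encode\<close>.
\<close>

datatype prog =
    Zero | Succ | PFst | PSnd | Query
  | Tuple prog prog
  | Comp prog prog
  | PrimRec prog prog
  | Mu prog

text \<open>\<open>eval f p x y\<close>: with oracle \<open>f\<close>, program \<open>p\<close> halts on input \<open>x\<close> with output \<open>y\<close>.\<close>

inductive eval :: "(nat \<Rightarrow> nat) \<Rightarrow> prog \<Rightarrow> nat \<Rightarrow> nat \<Rightarrow> bool" for f where
  eval_Zero: "eval f Zero x 0"
| eval_Succ: "eval f Succ x (Suc x)"
| eval_PFst: "eval f PFst x (fst (prod_decode x))"
| eval_PSnd: "eval f PSnd x (snd (prod_decode x))"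
| eval_Query: "eval f Query x (f x)"
| eval_Tuple: "eval f p x y \<Longrightarrow> eval f q x z \<Longrightarrow> eval f (Tuple p q) x (prod_encode (y, z))"
| eval_Comp: "eval f q x y \<Longrightarrow> eval f p y z \<Longrightarrow> eval f (Comp p q) x z"
| eval_PrimRec_0: "eval f p x y \<Longrightarrow> eval f (PrimRec p q) (prod_encode (x, 0)) y"
| eval_PrimRec_Suc:
    "eval f (PrimRec p q) (prod_encode (x, k)) y \<Longrightarrow>
     eval f q (prod_encode (x, prod_encode (k, y))) z \<Longrightarrow>
     eval f (PrimRec p q) (prod_encode (x, Suc k)) z"
| eval_Mu:
    "eval f p (prod_encode (x, k)) 0 \<Longrightarrow>
     (\<forall>j<k. \<exists>y>0. eval f p (prod_encode (x, j)) y) \<Longrightarrow>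
     eval f (Mu p) x k"

text \<open>
  The numbering has to be effective, so it is written out rather than taken from an
  unspecified countability witness such as \<open>to_nat\<close>.  It is a bijection, hence every
  natural number is an index.
\<close>

primrec prog_index :: "prog \<Rightarrow> nat" where
  "prog_index Zero = 0"
| "prog_index Succ = 1"
| "prog_index PFst = 2"
| "prog_index PSnd = 3"
| "prog_index Query = 4"
| "prog_index (Tuple p q) = 4 * prod_encode (prog_index p, prog_index q) + 5"
| "prog_index (Comp p q) = 4 * prod_encode (prog_index p, prog_index q) + 6"
| "prog_index (PrimRec p q) = 4 * prod_encode (prog_index p, prog_index q) + 7"
| "prog_index (Mu p) = 4 * prog_index p + 8"

lemma bij_prog_index: "bij prog_index"
proof (rule bijI)
  have ne: "4 * a + 5 \<noteq> 4 * b + (6::nat)" "4 * a + 5 \<noteq> 4 * b + (7::nat)"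
    "4 * a + 5 \<noteq> 4 * b + (8::nat)" "4 * a + 6 \<noteq> 4 * b + (7::nat)"
    "4 * a + 6 \<noteq> 4 * b + (8::nat)" "4 * a + 7 \<noteq> 4 * b + (8::nat)" for a b :: nat
    by presburger+
  have "prog_index p = prog_index q \<Longrightarrow> p = q" for p q
  proof (induction p arbitrary: q)
    case Zero then show ?case by (cases q) auto
  next
    case Succ then show ?case by (cases q) auto
  next
    case PFst then show ?case by (cases q) auto
  next
    case PSnd then show ?case by (cases q) auto
  next
    case Query then show ?case by (cases q) auto
  next
    case (Tuple p1 p2)
    then show ?case using ne by (cases q) auto
  next
    case (Comp p1 p2)
    then show ?case using ne ne[symmetric] by (cases q) auto
  next
    case (PrimRec p1 p2)
    then show ?case using ne ne[symmetric] by (cases q) auto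
  next
    case (Mu p)
    then show ?case using ne[symmetric] by (cases q) auto
  qed
  then show "inj prog_index" by (rule injI)
next
  have "\<exists>p. prog_index p = e" for e
  proof (induction e rule: less_induct)
    case (less e)
    show ?case
    proof (cases "e < 5")
      case True
      then consider "e = 0" | "e = 1" | "e = 2" | "e = 3" | "e = 4" by linarith
      then show ?thesis by cases (metis prog_index.simps)+
    next
      case False
      define k where "k = (e - 5) div 4"
      obtain a b where ab: "k = prod_encode (a, b)"
        by (metis prod_decode_inverse surj_pair)
      have k: "k < e" using False by (simp add: k_def)
      have "a < e" "b < e"
        using ab k le_prod_encode_1[of a b] le_prod_encode_2[of b a] by auto
      then obtain p q where pq: "prog_index p = a" "prog_index q = b" using less by blast
      obtain r where r: "prog_index r = k" using less k by blast
      consider "e = 4 * k + 5" | "e = 4 * k + 6" | "e = 4 * k + 7" | "e = 4 * k + 8"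
        using False unfolding k_def by linarith
      then show ?thesis by cases (metis prog_index.simps ab pq r)+
    qed
  qed
  then show "surj prog_index" by (metis surjI surj_def)
qed

definition Phi :: "nat \<Rightarrow> (nat \<Rightarrow> nat) \<Rightarrow> nat \<Rightarrow> nat \<Rightarrow> bool" where
  "Phi e f x y \<longleftrightarrow> eval f (inv prog_index e) x y"

text \<open>\<open>Phi_in e f A\<close>: the function computed by index \<open>e\<close> from \<open>f\<close> is total and lies in \<open>A\<close>.\<close>

definition Phi_in :: "nat \<Rightarrow> (nat \<Rightarrow> nat) \<Rightarrow> (nat \<Rightarrow> nat) set \<Rightarrow> bool" where
  "Phi_in e f A \<longleftrightarrow> (\<exists>g\<in>A. \<forall>x. Phi e f x (g x))"

definition computes :: "(nat \<Rightarrow> nat) \<Rightarrow> (nat \<Rightarrow> nat) \<Rightarrow> bool" where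
  "computes f g \<longleftrightarrow> (\<exists>e. \<forall>x. Phi e f x (g x))"

text \<open>Unrelativised computation is computation from the zero oracle.\<close>

definition computable :: "(nat \<Rightarrow> nat) \<Rightarrow> bool" where
  "computable g \<longleftrightarrow> computes (\<lambda>_. 0) g"


section \<open>Effective Borel classes of finite level\<close>

datatype bcomb = Cyl "nat list" | Neg bcomb | Conj bcomb bcomb

primrec bcomb_class :: "bcomb \<Rightarrow> (nat \<Rightarrow> nat) set" where
  "bcomb_class (Cyl s) = {f. \<forall>i<length s. f i = s ! i}"
| "bcomb_class (Neg b) = - bcomb_class b"
| "bcomb_class (Conj b c) = bcomb_class b \<inter> bcomb_class c"

primrec bcomb_index :: "bcomb \<Rightarrow> nat" where
  "bcomb_index (Cyl s) = 3 * list_encode s"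
| "bcomb_index (Neg b) = 3 * bcomb_index b + 1"
| "bcomb_index (Conj b c) = 3 * prod_encode (bcomb_index b, bcomb_index c) + 2"

lemma bij_bcomb_index: "bij bcomb_index"
proof (rule bijI)
  have ne: "3 * a \<noteq> 3 * b + (1::nat)" "3 * a \<noteq> 3 * b + (2::nat)"
    "3 * a + 1 \<noteq> 3 * b + (2::nat)" for a b :: nat
    by presburger+
  have "bcomb_index p = bcomb_index q \<Longrightarrow> p = q" for p q
  proof (induction p arbitrary: q)
    case (Cyl s)
    then show ?case using ne by (cases q) (auto simp: list_encode_eq)
  next
    case (Neg p)
    then show ?case using ne ne[symmetric] by (cases q) auto
  next
    case (Conj p1 p2)
    then show ?case using ne[symmetric] by (cases q) auto
  qed
  then show "inj bcomb_index" by (rule injI)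
next
  have "\<exists>p. bcomb_index p = e" for e
  proof (induction e rule: less_induct)
    case (less e)
    define k where "k = e div 3"
    obtain a b where ab: "k = prod_encode (a, b)"
      by (metis prod_decode_inverse surj_pair)
    consider "e = 3 * k" | "e = 3 * k + 1" | "e = 3 * k + 2"
      unfolding k_def by linarith
    then show ?case
    proof cases
      case 1
      then show ?thesis by (metis bcomb_index.simps(1) list_decode_inverse)
    next
      case 2
      then have "k < e" by simp
      then show ?thesis using less 2 by (metis bcomb_index.simps(2))
    next
      case 3
      then have "a < e" "b < e"
        using ab le_prod_encode_1[of a b] le_prod_encode_2[of b a] by auto
      then show ?thesis using less 3 ab by (metis bcomb_index.simps(3))
    qed
  qed
  then show "surj bcomb_index" by (metis surj_def)
qed

text \<open>
  The lightface class \<open>\<Pi>\<^sup>0\<^sub>n\<close> with index \<open>e\<close>.  At successor levels, \<open>e\<close> indexes a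
  computable partial sequence of \<open>\<Pi>\<^sup>0\<^sub>n\<close>-indices, and the class is the intersection of
  the complements of the classes listed.  Undefined entries contribute nothing,
  so every number is an index.
\<close>

primrec Pi_class :: "nat \<Rightarrow> nat \<Rightarrow> (nat \<Rightarrow> nat) set" where
  "Pi_class 0 e = bcomb_class (inv bcomb_index e)"
| "Pi_class (Suc n) e = {f. \<forall>i j. Phi e (\<lambda>_. 0) i j \<longrightarrow> f \<notin> Pi_class n j}"

definition uniformly_Pi :: "nat \<Rightarrow> (nat \<Rightarrow> (nat \<Rightarrow> nat) set) \<Rightarrow> bool" where
  "uniformly_Pi n V \<longleftrightarrow> (\<exists>h. computable h \<and> (\<forall>i. V i = Pi_class n (h i)))"


section \<open>Reducibilities between mass problems\<close>

type_synonym mass_problem = "(nat \<Rightarrow> nat) set"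

text \<open>\<open>reduc n A B\<close> is \<open>A \<le>\<^sub>n B\<close>; the element \<open>\<infinity>\<close> of \<^typ>\<open>enat\<close> plays the role of \<open>\<omega>\<close>.\<close>

definition reduc :: "enat \<Rightarrow> mass_problem \<Rightarrow> mass_problem \<Rightarrow> bool" where
  "reduc n A B \<longleftrightarrow>
    (case n of
      enat k \<Rightarrow>
        (\<exists>V e. uniformly_Pi k V \<and> B \<subseteq> (\<Union>i. V i) \<and> computable e \<and>
               (\<forall>i. \<forall>f \<in> B \<inter> V i. Phi_in (e i) f A))
    | \<infinity> \<Rightarrow> (\<forall>f\<in>B. \<exists>g\<in>A. computes f g))"

definition fjoin :: "(nat \<Rightarrow> nat) \<Rightarrow> (nat \<Rightarrow> nat) \<Rightarrow> nat \<Rightarrow> nat" where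
  "fjoin f g k = (if even k then f (k div 2) else g (k div 2))"

definition mjoin :: "mass_problem \<Rightarrow> mass_problem \<Rightarrow> mass_problem" where
  "mjoin A B = {fjoin f g | f g. f \<in> A \<and> g \<in> B}"

definition mmeet :: "mass_problem \<Rightarrow> mass_problem \<Rightarrow> mass_problem" where
  "mmeet A B = {case_nat 0 f | f. f \<in> A} \<union> {case_nat 1 g | g. g \<in> B}"


section \<open>The degree structures\<close>

definition reduc_equiv :: "enat \<Rightarrow> (mass_problem \<times> mass_problem) set" where
  "reduc_equiv n = {(A, B). reduc n A B \<and> reduc n B A}"

definition degrees :: "enat \<Rightarrow> mass_problem set set" where
  "degrees n = UNIV // reduc_equiv n"

definition deg :: "enat \<Rightarrow> mass_problem \<Rightarrow> mass_problem set" where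
  "deg n A = reduc_equiv n `` {A}"

definition deg_le :: "enat \<Rightarrow> mass_problem set \<Rightarrow> mass_problem set \<Rightarrow> bool" where
  "deg_le n a b \<longleftrightarrow> (\<exists>A\<in>a. \<exists>B\<in>b. reduc n A B)"

definition deg_zero :: "enat \<Rightarrow> mass_problem set" where
  "deg_zero n = deg n UNIV"

definition deg_one :: "enat \<Rightarrow> mass_problem set" where
  "deg_one n = deg n {}"

definition deg_join :: "enat \<Rightarrow> mass_problem set \<Rightarrow> mass_problem set \<Rightarrow> mass_problem set" where
  "deg_join n a b = (\<Union>A\<in>a. \<Union>B\<in>b. deg n (mjoin A B))"

definition deg_meet :: "enat \<Rightarrow> mass_problem set \<Rightarrow> mass_problem set \<Rightarrow> mass_problem set" where
  "deg_meet n a b = (\<Union>A\<in>a. \<Union>B\<in>b. deg n (mmeet A B))"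

text \<open>
  \<open>is_deg_imp n a b c\<close>: the degree \<open>c\<close> is \<open>a \<rightarrow> b\<close>, characterised by residuation in the
  Brouwer algebra of \<open>n\<close>-degrees (which determines it uniquely).
\<close>

definition is_deg_imp ::
  "enat \<Rightarrow> mass_problem set \<Rightarrow> mass_problem set \<Rightarrow> mass_problem set \<Rightarrow> bool" where
  "is_deg_imp n a b c \<longleftrightarrow>
    c \<in> degrees n \<and> (\<forall>x\<in>degrees n. deg_le n b (deg_join n a x) \<longleftrightarrow> deg_le n c x)"

text \<open>
  The map on degrees induced by the identity on mass problems, into the \<open>m\<close>-degrees.
  It is well defined on the \<open>n\<close>-degrees exactly when it sends \<open>deg n A\<close> to \<open>deg m A\<close>
  for all \<open>A\<close>.
\<close>

definition deg_map :: "enat \<Rightarrow> mass_problem set \<Rightarrow> mass_problem set" where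
  "deg_map m a = (\<Union>A\<in>a. deg m A)"

end

theory Submission
  imports Defs
begin

text \<open>
  The map is well defined and preserves the lattice structure because every \<open>\<le>\<^sub>n\<close> is a preorder
  with \<open>\<oplus>\<close> and \<open>\<otimes>\<close> as least upper and greatest lower bounds, and \<open>\<le>\<^sub>n\<close> implies \<open>\<le>\<^sub>m\<close>.
  Transitivity is the delicate point: pulling a \<open>\<Pi>\<^sup>0\<^sub>n\<close> cover back along a partial functional is
  unproblematic for \<open>n \<ge> 1\<close>, where divergence may be ignored, but not for \<open>n = 0\<close>; there a clopen
  cover can be searched, so that the cover may be taken trivial.

  Implication is not preserved from \<open>n = 0\<close> to \<open>m = \<omega>\<close>.  Take \<open>X\<close> noncomputable, \<open>\<B> = {X}\<close> and
  \<open>\<A>\<close> the set of finite variants of \<open>X\<close>.  Every element of \<open>\<A>\<close> computes \<open>X\<close>, so \<open>\<A> \<rightarrow> \<B>\<close> is \<open>0\<close>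
  at level \<open>\<omega>\<close>.  At level \<open>0\<close> the implication is represented by the \<open>e\<close>-prefixed functions \<open>f\<close> with
  \<open>\<Phi>\<^sub>e(g \<oplus> f) = X\<close> for all \<open>g \<in> \<A>\<close>; a computable member would yield a single functional computing
  \<open>X\<close> from all of its finite variants, and since these are dense, \<open>X\<close> would be computable.
\<close>

section \<open>Computable functionals\<close>

abbreviation pfst :: "nat \<Rightarrow> nat" where "pfst x \<equiv> fst (prod_decode x)"
abbreviation psnd :: "nat \<Rightarrow> nat" where "psnd x \<equiv> snd (prod_decode x)"

inductive_cases eval_elims:
  "eval f Zero x y" "eval f Succ x y" "eval f PFst x y" "eval f PSnd x y" "eval f Query x y"
  "eval f (Tuple p q) x y" "eval f (Comp p q) x y"

inductive_cases eval_PrimRecE: "eval f (PrimRec p q) x y"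

inductive_cases eval_MuE: "eval f (Mu p) x y"

lemma eval_det: "eval f p x y \<Longrightarrow> eval f p x z \<Longrightarrow> y = z"
proof (induction arbitrary: z rule: eval.induct)
  case (eval_Tuple p x y q w)
  then show ?case by (metis eval_elims(6))
next
  case (eval_Comp q x y p w)
  then show ?case by (metis eval_elims(7))
next
  case (eval_PrimRec_0 p x y q)
  from eval_PrimRec_0.prems show ?case
    by (rule eval_PrimRecE) (auto simp: eval_PrimRec_0.IH prod_encode_eq)
next
  case (eval_PrimRec_Suc p q x k y w)
  from eval_PrimRec_Suc.prems show ?case
    by (rule eval_PrimRecE) (auto simp: prod_encode_eq dest!: eval_PrimRec_Suc.IH)
next
  case (eval_Mu p x k)
  from eval_Mu.prems have z: "eval f p (prod_encode (x, z)) 0"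
    "\<forall>j<z. \<exists>y>0. eval f p (prod_encode (x, j)) y"
    by (auto elim: eval_MuE)
  have "\<not> z < k" using eval_Mu.IH(2) z(1) by blast
  moreover have "\<not> k < z" using eval_Mu.IH(1) z(2) by (metis less_irrefl)
  ultimately show ?case by simp
qed (auto elim: eval_elims)

text \<open>One program has to serve all oracles and halt on all inputs. The curried type allows two
  readings: \<open>F\<close> maps the oracle \<open>f\<close> to the function \<open>F f\<close>,
  and \<open>eff (\<lambda>_. h)\<close> expresses plain computability of \<open>h\<close>.\<close>

definition eff :: "((nat \<Rightarrow> nat) \<Rightarrow> nat \<Rightarrow> nat) \<Rightarrow> bool" where
  "eff F \<longleftrightarrow> (\<exists>p. \<forall>f x. eval f p x (F f x))"

text \<open>Truth is coded by 0, so that \<open>Mu\<close> stops at a witness and a recursion of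
  length 0 selects the true branch.\<close>

definition dec :: "((nat \<Rightarrow> nat) \<Rightarrow> nat \<Rightarrow> bool) \<Rightarrow> bool" where
  "dec P \<longleftrightarrow> eff (\<lambda>f x. if P f x then 0 else 1)"

lemma eff_cong: "eff F \<Longrightarrow> (\<And>f x. F f x = G f x) \<Longrightarrow> eff G"
  unfolding eff_def by simp

lemma eval_id: "eval f (Tuple PFst PSnd) x x"
  using eval_Tuple[OF eval_PFst eval_PSnd, of f x] by simp

lemma eff_id: "eff (\<lambda>f x. x)"
  unfolding eff_def using eval_id by blast

lemma eff_comp: "eff F \<Longrightarrow> eff G \<Longrightarrow> eff (\<lambda>f x. F f (G f x))"
  unfolding eff_def by (meson eval_Comp)

lemma eff_query: "eff G \<Longrightarrow> eff (\<lambda>f x. f (G f x))"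
  by (rule eff_comp) (auto simp: eff_def intro: eval_Query)

lemma eff_Suc: "eff G \<Longrightarrow> eff (\<lambda>f x. Suc (G f x))"
  by (rule eff_comp[of "\<lambda>f. Suc"]) (auto simp: eff_def intro: eval_Succ)

lemma eff_pfst: "eff G \<Longrightarrow> eff (\<lambda>f x. pfst (G f x))"
  by (rule eff_comp[of "\<lambda>f. pfst"]) (auto simp: eff_def intro: eval_PFst)

lemma eff_psnd: "eff G \<Longrightarrow> eff (\<lambda>f x. psnd (G f x))"
  by (rule eff_comp[of "\<lambda>f. psnd"]) (auto simp: eff_def intro: eval_PSnd)

lemma eff_pair: "eff F \<Longrightarrow> eff G \<Longrightarrow> eff (\<lambda>f x. prod_encode (F f x, G f x))"
  unfolding eff_def by (meson eval_Tuple)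

primrec const_prog :: "nat \<Rightarrow> prog" where
  "const_prog 0 = Zero"
| "const_prog (Suc n) = Comp Succ (const_prog n)"

lemma eval_const: "eval f (const_prog n) x n"
  by (induction n) (auto intro: eval_Zero eval_Succ eval_Comp)

lemma eff_const: "eff (\<lambda>f x. c)"
  unfolding eff_def using eval_const by blast

text \<open>\<open>PrimRec\<close> hands parameter, counter and previous value to its step as one
  nested pair; hence the uncurried form of the assumption on \<open>S\<close>. The closure
  properties below rest on this lemma.\<close>

lemma eff_rec:
  assumes "eff A" "eff N" and S: "eff (\<lambda>f z. S f (pfst z) (pfst (psnd z)) (psnd (psnd z)))"
  shows "eff (\<lambda>f x. rec_nat (A f x) (S f x) (N f x))"
proof -
  obtain p q where p: "\<And>f x. eval f p x (A f x)"
    and q: "\<And>f z. eval f q z (S f (pfst z) (pfst (psnd z)) (psnd (psnd z)))"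
    using assms unfolding eff_def by metis
  have "eval f (PrimRec p q) (prod_encode (x, n)) (rec_nat (A f x) (S f x) n)" for f x n
  proof (induction n)
    case 0
    then show ?case by (simp add: eval_PrimRec_0 p)
  next
    case (Suc n)
    then show ?case
      using eval_PrimRec_Suc[OF Suc q] by simp
  qed
  then have "eval f (PrimRec p q) z (rec_nat (A f (pfst z)) (S f (pfst z)) (psnd z))" for f z
    by (metis prod.collapse prod_decode_inverse)
  then have "eff (\<lambda>f z. rec_nat (A f (pfst z)) (S f (pfst z)) (psnd z))"
    unfolding eff_def by blast
  from eff_comp[OF this eff_pair[OF eff_id assms(2)]] show ?thesis by simp
qed

section \<open>Arithmetic, case distinction and decidable predicates\<close>

lemma eff_add: assumes "eff F" "eff G" shows "eff (\<lambda>f x. F f x + G f x)"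
proof -
  have eq: "rec_nat a (\<lambda>_ y. Suc y) b = a + b" for a b by (induction b) auto
  have "eff (\<lambda>f x. rec_nat (F f x) (\<lambda>_ y. Suc y) (G f x))"
    by (intro assms eff_rec eff_Suc eff_psnd eff_id)
  then show ?thesis by (simp only: eq)
qed

lemma eff_mult: assumes "eff F" "eff G" shows "eff (\<lambda>f x. F f x * G f x)"
proof -
  have eq: "rec_nat 0 (\<lambda>_ y. y + a) b = a * b" for a b :: nat by (induction b) auto
  have "eff (\<lambda>f x. rec_nat 0 (\<lambda>_ y. y + F f x) (G f x))"
    by (intro assms eff_rec eff_const eff_add eff_comp[of F] eff_pfst eff_psnd eff_id)
  then show ?thesis by (simp only: eq)
qed

lemma eff_diff: assumes "eff F" "eff G" shows "eff (\<lambda>f x. F f x - G f x)"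
proof -
  have pred: "rec_nat 0 (\<lambda>k _. k) b = b - 1" for b :: nat by (cases b) auto
  have "eff (\<lambda>f x. rec_nat 0 (\<lambda>k _. k) (H f x))" if "eff H" for H
    by (intro eff_rec that eff_const eff_pfst eff_psnd eff_id)
  then have eff_pred: "eff (\<lambda>f x. H f x - 1)" if "eff H" for H
    using that by (simp only: pred)
  have eq: "rec_nat a (\<lambda>_ y. y - 1) b = a - b" for a b :: nat by (induction b) auto
  have "eff (\<lambda>f x. rec_nat (F f x) (\<lambda>_ y. y - 1) (G f x))"
    by (intro assms eff_rec eff_pred eff_psnd eff_id)
  then show ?thesis by (simp only: eq)
qed

lemmas eff_intros = eff_id eff_const eff_query eff_Suc eff_pfst eff_psnd eff_pair
  eff_add eff_mult eff_diff

lemma eff_if: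
  assumes "dec P" "eff F" "eff G" shows "eff (\<lambda>f x. if P f x then F f x else G f x)"
proof -
  \<comment> \<open>A case distinction is a recursion of length 0 or 1 whose step ignores its
    arguments.\<close>
  have "eff (\<lambda>f x. rec_nat (F f x) (\<lambda>_ _. G f x) (if P f x then 0 else 1))"
    by (intro assms eff_rec assms(1)[unfolded dec_def] eff_comp[of G] eff_intros)
  then show ?thesis by (rule eff_cong) simp
qed

lemma dec_const: "dec (\<lambda>f x. b)"
  unfolding dec_def by (rule eff_const)

lemma dec_comp: "dec P \<Longrightarrow> eff G \<Longrightarrow> dec (\<lambda>f x. P f (G f x))"
  unfolding dec_def by (rule eff_comp)

lemma dec_not:
  assumes "dec P" shows "dec (\<lambda>f x. \<not> P f x)"
  unfolding dec_def
  by (rule eff_cong[OF eff_if[OF assms eff_const[of 1] eff_const[of 0]]]) simp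

lemma dec_conj:
  assumes "dec P" "dec Q" shows "dec (\<lambda>f x. P f x \<and> Q f x)"
  unfolding dec_def
  by (rule eff_cong[OF eff_if[OF assms(1) assms(2)[unfolded dec_def] eff_const[of 1]]]) simp

lemma dec_disj: "dec P \<Longrightarrow> dec Q \<Longrightarrow> dec (\<lambda>f x. P f x \<or> Q f x)"
  using dec_not[OF dec_conj[OF dec_not dec_not], of P Q] by simp

lemma dec_cong: "dec P \<Longrightarrow> (\<And>f x. P f x \<longleftrightarrow> Q f x) \<Longrightarrow> dec Q"
  unfolding dec_def by simp

lemma dec_imp: "dec P \<Longrightarrow> dec Q \<Longrightarrow> dec (\<lambda>f x. P f x \<longrightarrow> Q f x)"
  by (rule dec_cong[OF dec_disj[OF dec_not]]) auto

lemma dec_le: assumes "eff F" "eff G" shows "dec (\<lambda>f x. F f x \<le> G f x)"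
proof -
  have "eff (\<lambda>f x. rec_nat 0 (\<lambda>_ _. 1) (F f x - G f x))"
    using assms by (intro eff_rec eff_intros)
  moreover have "rec_nat 0 (\<lambda>_ _. 1) (a - b) = (if a \<le> b then 0 else 1 :: nat)" for a b :: nat
    by (cases "a - b") auto
  ultimately show ?thesis unfolding dec_def by (simp only:)
qed

lemma dec_eq: "eff F \<Longrightarrow> eff G \<Longrightarrow> dec (\<lambda>f x. F f x = G f x)"
  by (rule dec_cong[OF dec_conj[OF dec_le dec_le, of F G G F]]) auto

lemma dec_less: "eff F \<Longrightarrow> eff G \<Longrightarrow> dec (\<lambda>f x. F f x < G f x)"
  by (rule dec_cong[OF dec_not[OF dec_le, of G F]]) auto

lemma dec_bex:
  assumes "eff B" "dec (\<lambda>f z. P f (pfst z) (psnd z))"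
  shows "dec (\<lambda>f x. \<exists>i<B f x. P f x i)"
proof -
  have "dec (\<lambda>f z. P f (pfst z) (pfst (psnd z)))"
    using dec_comp[OF assms(2), of "\<lambda>f z. prod_encode (pfst z, pfst (psnd z))"]
    by (simp add: eff_intros)
  then have "eff (\<lambda>f x. rec_nat 1 (\<lambda>k y. if P f x k then 0 else y) (B f x))"
    by (intro assms eff_rec eff_if eff_intros) auto
  moreover have "rec_nat 1 (\<lambda>k y. if Q k then 0 else y) n = (if \<exists>i<n. Q i then 0 else 1 :: nat)"
    for Q n
    by (induction n) (auto simp: less_Suc_eq)
  ultimately show ?thesis unfolding dec_def by (simp only:)
qed

lemma dec_ball:
  assumes "eff B" "dec (\<lambda>f z. P f (pfst z) (psnd z))"
  shows "dec (\<lambda>f x. \<forall>i<B f x. P f x i)"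
  using dec_not[OF dec_bex[OF assms(1) dec_not[OF assms(2)]]] by simp

lemma dec_ex_bounded:
  assumes "dec (\<lambda>f z. P f (pfst z) (psnd z))" "eff B" "\<And>f x i. P f x i \<Longrightarrow> i < B f x"
  shows "dec (\<lambda>f x. \<exists>i. P f x i)"
proof -
  have "(\<exists>i. P f x i) \<longleftrightarrow> (\<exists>i<B f x. P f x i)" for f x
    using assms(3) by blast
  then show ?thesis using dec_bex[OF assms(2,1)] by (simp only:)
qed

lemmas dec_intros = dec_const dec_not dec_conj dec_disj dec_imp dec_le dec_eq dec_less
  dec_bex dec_ball

text \<open>Unbounded minimisation. Halting is claimed only where a witness exists; elsewhere the
  program diverges, which is what partial functionals such as the universal one require.\<close>

lemma search:
  assumes "dec (\<lambda>f z. R f (pfst z) (psnd z))"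
  shows "\<exists>p. \<forall>f x. (\<exists>n. R f x n) \<longrightarrow> eval f p x (LEAST n. R f x n)"
proof -
  obtain q where q: "\<And>f z. eval f q z (if R f (pfst z) (psnd z) then 0 else 1)"
    using assms unfolding dec_def eff_def by blast
  have q': "eval f q (prod_encode (x, n)) (if R f x n then 0 else 1)" for f x n
    using q[of f "prod_encode (x, n)"] by simp
  have "eval f (Mu q) x (LEAST n. R f x n)" if "\<exists>n. R f x n" for f x
  proof (rule eval_Mu)
    show "eval f q (prod_encode (x, LEAST n. R f x n)) 0"
      using q'[of f x "LEAST n. R f x n"] LeastI_ex[OF that] by simp
    show "\<forall>j<LEAST n. R f x n. \<exists>y>0. eval f q (prod_encode (x, j)) y"
    proof (intro allI impI)
      fix j assume "j < (LEAST n. R f x n)"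
      then have "\<not> R f x j" by (rule not_less_Least)
      then show "\<exists>y>0. eval f q (prod_encode (x, j)) y" using q'[of f x j] by auto
    qed
  qed
  then show ?thesis by blast
qed

lemma eff_Least:
  assumes "dec (\<lambda>f z. R f (pfst z) (psnd z))" "\<And>f x. \<exists>n. R f x n"
  shows "eff (\<lambda>f x. LEAST n. R f x n)"
  using search[OF assms(1)] assms(2) unfolding eff_def by blast

lemma eff_div:
  assumes "eff F" "c > 0" shows "eff (\<lambda>f x. F f x div c)"
proof -
  \<comment> \<open>Division by a constant becomes a search for the first multiple of
    \<open>c\<close> exceeding \<open>a\<close>.\<close>
  have "(LEAST k. a < c * Suc k) = a div c" for a
  proof (rule Least_equality)
    show "a < c * Suc (a div c)" using assms(2) dividend_less_times_div by auto
    show "a div c \<le> k" if "a < c * Suc k" for k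
      using less_mult_imp_div_less[of a "Suc k" c] that by (simp add: mult.commute)
  qed
  moreover have "eff (\<lambda>f x. LEAST k. F f x < c * Suc k)"
  proof (rule eff_Least)
    show "dec (\<lambda>f z. F f (pfst z) < c * Suc (psnd z))"
      by (intro assms dec_less eff_comp[of F] eff_intros)
    show "\<exists>k. F f x < c * Suc k" for f x
      using assms(2) by (intro exI[of _ "F f x"]) (cases c, auto)
  qed
  ultimately show ?thesis by (simp only:)
qed

section \<open>Coded lists\<close>

definition nth0 :: "nat list \<Rightarrow> nat \<Rightarrow> nat" where
  "nth0 xs i = (if i < length xs then xs ! i else 0)"

lemma psnd_0: "psnd 0 = 0" and pfst_0: "pfst 0 = 0"
  by (simp_all add: prod_decode_def prod_decode_aux.simps)

text \<open>A nonempty list is coded by the successor of a pair. The empty list needs no special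
  treatment: its code 0 is fixed by truncated subtraction, and both projections of 0 are 0.\<close>

lemma code_tl: "psnd (list_encode xs - 1) = list_encode (tl xs)"
  by (cases xs) (auto simp: psnd_0)

lemma code_hd: "pfst (list_encode xs - 1) = nth0 xs 0"
  by (cases xs) (auto simp: pfst_0 nth0_def)

lemma eff_drop:
  assumes "eff C" "eff I"
  shows "eff (\<lambda>f x. list_encode (drop (I f x) (list_decode (C f x))))"
proof -
  have "rec_nat c (\<lambda>_ y. psnd (y - 1)) i = list_encode (drop i (list_decode c))" for c i
  proof (induction i)
    case (Suc i)
    then show ?case using code_tl by (simp add: drop_Suc drop_tl)
  qed auto
  moreover have "eff (\<lambda>f x. rec_nat (C f x) (\<lambda>_ y. psnd (y - 1)) (I f x))"
    by (intro assms eff_rec eff_intros)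
  ultimately show ?thesis by (simp only:)
qed

lemma eff_nth0:
  assumes "eff C" "eff I"
  shows "eff (\<lambda>f x. nth0 (list_decode (C f x)) (I f x))"
proof -
  have eq: "pfst (list_encode (drop i xs) - 1) = nth0 xs i" for xs i
    unfolding code_hd by (auto simp: nth0_def)
  have "eff (\<lambda>f x. pfst (list_encode (drop (I f x) (list_decode (C f x))) - 1))"
    by (intro assms eff_intros eff_drop)
  then show ?thesis by (simp only: eq)
qed

lemma eff_length:
  assumes "eff C" shows "eff (\<lambda>f x. length (list_decode (C f x)))"
proof -
  \<comment> \<open>Only the empty list has code 0, so the length is the least number of deletions
    that leaves 0.\<close>
  have *: "length xs \<le> n \<longleftrightarrow> list_encode (drop n xs) = 0" for xs n
    by (cases "drop n xs") (auto dest: arg_cong[of _ _ length])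
  have "(LEAST n. length xs \<le> n) = length xs" for xs :: "nat list"
    by (rule Least_equality) auto
  moreover have "eff (\<lambda>f x. LEAST n. length (list_decode (C f x)) \<le> n)"
  proof (rule eff_Least)
    show "dec (\<lambda>f z. length (list_decode (C f (pfst z))) \<le> psnd z)"
      unfolding * by (intro assms dec_intros eff_drop eff_comp[of C] eff_intros)
  qed auto
  ultimately show ?thesis by (simp only:)
qed

lemmas eff_list_intros = eff_drop eff_nth0 eff_length

lemma dec_list_all:
  assumes "eff C" "dec (\<lambda>f z. P f (pfst z) (psnd z))"
  shows "dec (\<lambda>f x. \<forall>j\<in>set (list_decode (C f x)). P f x j)"
proof -
  have "(\<forall>j\<in>set xs. Q j) \<longleftrightarrow> (\<forall>i<length xs. Q (nth0 xs i))" for xs Q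
    by (auto simp: nth0_def all_set_conv_all_nth)
  moreover have "dec (\<lambda>f z. P f (pfst z) (nth0 (list_decode (C f (pfst z))) (psnd z)))"
    using dec_comp[OF assms(2),
        of "\<lambda>f z. prod_encode (pfst z, nth0 (list_decode (C f (pfst z))) (psnd z))"]
    by (simp add: eff_intros eff_list_intros eff_comp[of C] assms)
  ultimately show ?thesis
    by (simp only:) (intro assms dec_intros eff_list_intros)
qed

lemma dec_mem:
  assumes "eff M" "eff C" shows "dec (\<lambda>f x. M f x \<in> set (list_decode (C f x)))"
proof -
  have "dec (\<lambda>f x. \<not> (\<forall>j\<in>set (list_decode (C f x)). j \<noteq> M f x))"
    by (intro assms dec_intros dec_list_all eff_intros eff_comp[of M])
  then show ?thesis by simp
qed

text \<open>Source of all bounds for quantifiers that range over members of a coded list.\<close>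

lemma mem_less_code: "m \<in> set xs \<Longrightarrow> m < list_encode xs"
proof (induction xs)
  case (Cons a xs)
  then show ?case
    using le_prod_encode_1[of a "list_encode xs"] le_prod_encode_2[of "list_encode xs" a]
    by (auto simp: less_Suc_eq_le)
qed auto

section \<open>Derivations and the normal form theorem\<close>

text \<open>A computation is certified by a list of judgments "index \<open>e\<close> on input \<open>x\<close> outputs \<open>y\<close>", each
  justified by later ones.  Oracle calls are left unchecked by \<open>valid\<close> and compared with the oracle
  only in \<open>agrees\<close>; this separation gives the use principle.\<close>

definition jd :: "nat \<Rightarrow> nat \<Rightarrow> nat \<Rightarrow> nat" where
  "jd e x y = prod_encode (e, prod_encode (x, y))"

text \<open>The composite indices have the form 4k+5 to 4k+8, and \<open>(e - 5) div 4\<close>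
  recovers the payload k from each of them; for the binary constructors k codes the pair of
  subprogram indices. The clauses then mirror the rules of \<open>eval\<close>.\<close>

definition step_ok :: "nat list \<Rightarrow> nat \<Rightarrow> nat \<Rightarrow> nat \<Rightarrow> bool" where
  "step_ok L e x y \<longleftrightarrow>
    (let k = (e - 5) div 4; a = pfst k; b = psnd k in
      e = 0 \<and> y = 0 \<or> e = 1 \<and> y = Suc x \<or> e = 2 \<and> y = pfst x \<or> e = 3 \<and> y = psnd x \<or> e = 4 \<or>
      e = 4 * k + 5 \<and> jd a x (pfst y) \<in> set L \<and> jd b x (psnd y) \<in> set L \<or>
      e = 4 * k + 6 \<and> (\<exists>u. jd b x u \<in> set L \<and> jd a u y \<in> set L) \<or>
      e = 4 * k + 7 \<and> psnd x = 0 \<and> jd a (pfst x) y \<in> set L \<or>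
      e = 4 * k + 7 \<and> psnd x > 0 \<and>
        (\<exists>u. jd e (prod_encode (pfst x, psnd x - 1)) u \<in> set L \<and>
             jd b (prod_encode (pfst x, prod_encode (psnd x - 1, u))) y \<in> set L) \<or>
      e = 4 * k + 8 \<and> jd k (prod_encode (x, y)) 0 \<in> set L \<and>
        (\<forall>j<y. \<exists>u. jd k (prod_encode (x, j)) u \<in> set L \<and> u > 0))"

primrec valid :: "nat list \<Rightarrow> bool" where
  "valid [] = True"
| "valid (j # L) = (step_ok L (pfst j) (pfst (psnd j)) (psnd (psnd j)) \<and> valid L)"

definition agrees :: "(nat \<Rightarrow> nat) \<Rightarrow> nat list \<Rightarrow> bool" where
  "agrees f L \<longleftrightarrow> (\<forall>j\<in>set L. pfst j = 4 \<longrightarrow> f (pfst (psnd j)) = psnd (psnd j))"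

text \<open>The length condition is essential: beyond the end of \<open>s\<close> the default 0 of
  \<open>nth0\<close> would pass for an oracle answer.\<close>

definition agrees_fin :: "nat list \<Rightarrow> nat list \<Rightarrow> bool" where
  "agrees_fin s L \<longleftrightarrow>
    (\<forall>j\<in>set L. pfst j = 4 \<longrightarrow>
       pfst (psnd j) < length s \<and> nth0 s (pfst (psnd j)) = psnd (psnd j))"

text \<open>The value of a recorded judgment is bounded by the code of the list, so the intermediate
  values quantified in \<open>step_ok\<close> can be found by bounded search.\<close>

lemma mem_jd_less: "jd e x u \<in> set (list_decode c) \<Longrightarrow> u < c"
  using mem_less_code[of "jd e x u" "list_decode c"]
    le_prod_encode_2[of "prod_encode (x, u)" e] le_prod_encode_2[of u x]
  by (simp add: jd_def)

lemma dec_mem_jd: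
  assumes "eff C" "eff E" "eff X" "eff Y"
  shows "dec (\<lambda>f x. jd (E f x) (X f x) (Y f x) \<in> set (list_decode (C f x)))"
  unfolding jd_def by (intro assms dec_mem eff_intros)

lemma dec_ex_mem_jd:
  assumes "eff C" "eff E" "eff X" "dec (\<lambda>f z. P f (pfst z) (psnd z))"
  shows "dec (\<lambda>f x. \<exists>u. jd (E f x) (X f x) u \<in> set (list_decode (C f x)) \<and> P f x u)"
proof (rule dec_ex_bounded)
  show "dec (\<lambda>f z. jd (E f (pfst z)) (X f (pfst z)) (psnd z) \<in> set (list_decode (C f (pfst z)))
      \<and> P f (pfst z) (psnd z))"
    by (intro dec_conj assms dec_mem_jd eff_comp[of C] eff_comp[of E] eff_comp[of X] eff_intros)
qed (use assms mem_jd_less in auto)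

lemma dec_step_ok:
  assumes "eff C" "eff E" "eff X" "eff Y"
  shows "dec (\<lambda>f x. step_ok (list_decode (C f x)) (E f x) (X f x) (Y f x))"
  unfolding step_ok_def Let_def
  by (intro assms eff_comp[of C] eff_comp[of E] eff_comp[of X] eff_comp[of Y] dec_ex_mem_jd
        dec_mem_jd dec_intros eff_intros eff_div; simp)

text \<open>Replaces the recursion on lists by a bounded quantifier over positions, the form in
  which decidability is available. Entry \<open>i\<close> must be justified by the entries after
  it.\<close>

lemma valid_iff:
  "valid L \<longleftrightarrow> (\<forall>i<length L. step_ok (drop (Suc i) L) (pfst (nth0 L i))
     (pfst (psnd (nth0 L i))) (psnd (psnd (nth0 L i))))"
proof (induction L)
  case (Cons j L)
  have "nth0 (j # L) (Suc i) = nth0 L i" "nth0 (j # L) 0 = j" for i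
    by (auto simp: nth0_def)
  then show ?case using Cons by (simp add: All_less_Suc2)
qed simp

lemma dec_valid:
  assumes "eff C" shows "dec (\<lambda>f x. valid (list_decode (C f x)))"
proof -
  have "dec (\<lambda>f x. \<forall>i<length (list_decode (C f x)).
     step_ok (list_decode (list_encode (drop (Suc i) (list_decode (C f x)))))
       (pfst (nth0 (list_decode (C f x)) i)) (pfst (psnd (nth0 (list_decode (C f x)) i)))
       (psnd (psnd (nth0 (list_decode (C f x)) i))))"
    by (intro assms eff_comp[of C] dec_intros dec_step_ok eff_intros eff_list_intros)
  then show ?thesis by (simp add: valid_iff)
qed

lemma dec_agrees: assumes "eff C" shows "dec (\<lambda>f x. agrees f (list_decode (C f x)))"
  unfolding agrees_def
  by (intro assms eff_comp[of C] dec_intros dec_list_all eff_intros)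

lemma dec_agrees_fin:
  assumes "eff C" "eff S"
  shows "dec (\<lambda>f x. agrees_fin (list_decode (S f x)) (list_decode (C f x)))"
  unfolding agrees_fin_def
  by (intro assms eff_comp[of C] eff_comp[of S] dec_intros dec_list_all eff_list_intros eff_intros)

lemma inv_prog_index [simp]: "inv prog_index (prog_index p) = p"
  using bij_prog_index by (simp add: bij_is_inj)

lemma prog_index_inv [simp]: "prog_index (inv prog_index e) = e"
  using bij_prog_index by (simp add: bij_is_surj surj_f_inv_f)

lemma Phi_index [simp]: "Phi (prog_index p) f x y \<longleftrightarrow> eval f p x y"
  by (simp add: Phi_def)

lemma inv_prog_index_simps:
  "inv prog_index 0 = Zero" "inv prog_index 1 = Succ" "inv prog_index 2 = PFst"
  "inv prog_index 3 = PSnd" "inv prog_index 4 = Query"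
  "inv prog_index (4 * prod_encode (a, b) + 5) = Tuple (inv prog_index a) (inv prog_index b)"
  "inv prog_index (4 * prod_encode (a, b) + 6) = Comp (inv prog_index a) (inv prog_index b)"
  "inv prog_index (4 * prod_encode (a, b) + 7) = PrimRec (inv prog_index a) (inv prog_index b)"
  "inv prog_index (4 * k + 8) = Mu (inv prog_index k)"
  using inv_prog_index[of Zero] inv_prog_index[of Succ] inv_prog_index[of PFst]
    inv_prog_index[of PSnd] inv_prog_index[of Query]
    inv_prog_index[of "Tuple (inv prog_index a) (inv prog_index b)"]
    inv_prog_index[of "Comp (inv prog_index a) (inv prog_index b)"]
    inv_prog_index[of "PrimRec (inv prog_index a) (inv prog_index b)"]
    inv_prog_index[of "Mu (inv prog_index k)"]
  by (simp_all del: inv_prog_index)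

text \<open>Each disjunct of \<open>step_ok\<close> is one introduction rule of \<open>eval\<close>,
  read through the numbering. The query clause alone says nothing about \<open>y\<close>; it is
  settled by the last assumption.\<close>

lemma step_ok_sound:
  assumes "step_ok L e x y"
    and L: "\<And>e x y. jd e x y \<in> set L \<Longrightarrow> Phi e f x y" and "e = 4 \<Longrightarrow> f x = y"
  shows "Phi e f x y"
proof -
  define k a b where "k = (e - 5) div 4" "a = pfst k" "b = psnd k"
  then have k: "k = prod_encode (a, b)" by simp
  obtain x1 x2 where x: "x = prod_encode (x1, x2)" by (metis prod_decode_inverse surj_pair)
  obtain y1 y2 where y: "y = prod_encode (y1, y2)" by (metis prod_decode_inverse surj_pair)
  have proj: "pfst x = x1" "psnd x = x2" "pfst y = y1" "psnd y = y2"
    by (simp_all add: x y)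
  note ev = L[unfolded Phi_def]
  have "e = 0 \<and> y = 0 \<or> e = 1 \<and> y = Suc x \<or> e = 2 \<and> y = pfst x \<or> e = 3 \<and> y = psnd x \<or> e = 4 \<or>
      e = 4 * k + 5 \<and> jd a x (pfst y) \<in> set L \<and> jd b x (psnd y) \<in> set L \<or>
      e = 4 * k + 6 \<and> (\<exists>u. jd b x u \<in> set L \<and> jd a u y \<in> set L) \<or>
      e = 4 * k + 7 \<and> psnd x = 0 \<and> jd a (pfst x) y \<in> set L \<or>
      e = 4 * k + 7 \<and> psnd x > 0 \<and>
        (\<exists>u. jd e (prod_encode (pfst x, psnd x - 1)) u \<in> set L \<and>
             jd b (prod_encode (pfst x, prod_encode (psnd x - 1, u))) y \<in> set L) \<or>
      e = 4 * k + 8 \<and> jd k (prod_encode (x, y)) 0 \<in> set L \<and>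
        (\<forall>j<y. \<exists>u. jd k (prod_encode (x, j)) u \<in> set L \<and> u > 0)"
    using assms(1) unfolding step_ok_def Let_def k_a_b_def .
  then consider "e = 0" "y = 0" | "e = 1" "y = Suc x" | "e = 2" "y = pfst x" | "e = 3" "y = psnd x"
    | "e = 4" | "e = 4 * k + 5" "jd a x y1 \<in> set L" "jd b x y2 \<in> set L"
    | u where "e = 4 * k + 6" "jd b x u \<in> set L" "jd a u y \<in> set L"
    | "e = 4 * k + 7" "x2 = 0" "jd a x1 y \<in> set L"
    | u where "e = 4 * k + 7" "x2 > 0" "jd e (prod_encode (x1, x2 - 1)) u \<in> set L"
      "jd b (prod_encode (x1, prod_encode (x2 - 1, u))) y \<in> set L"
    | "e = 4 * k + 8" "jd k (prod_encode (x, y)) 0 \<in> set L"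
      "\<forall>j<y. \<exists>u. jd k (prod_encode (x, j)) u \<in> set L \<and> u > 0"
    unfolding proj by blast
  then show ?thesis
  proof cases
    case 2
    then show ?thesis using eval_Succ unfolding Phi_def by (simp only: inv_prog_index_simps)
  next
    case 5
    then show ?thesis using assms(3) eval_Query[of f x] by (simp add: Phi_def inv_prog_index_simps)
  next
    case 6
    then show ?thesis using eval_Tuple ev unfolding Phi_def k y by (simp add: inv_prog_index_simps)
  next
    case 7
    then show ?thesis using eval_Comp ev unfolding Phi_def k by (simp add: inv_prog_index_simps) blast
  next
    case 8
    then show ?thesis using eval_PrimRec_0 ev unfolding Phi_def k x
      by (simp add: inv_prog_index_simps)
  next
    case 9
    then have "x2 = Suc (x2 - 1)" by simp
    then show ?thesis
      using eval_PrimRec_Suc[of f _ _ x1 "x2 - 1" u y] ev[OF 9(3)] ev[OF 9(4)] 9(1)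
      unfolding Phi_def k x by (simp add: inv_prog_index_simps)
  next
    case 10
    then have "\<forall>j<y. \<exists>u>0. eval f (inv prog_index k) (prod_encode (x, j)) u"
      using ev by blast
    then show ?thesis using eval_Mu ev 10 unfolding Phi_def by (simp add: inv_prog_index_simps)
  qed (auto simp: Phi_def inv_prog_index_simps intro: eval_Zero eval_PFst eval_PSnd)
qed

lemma valid_sound:
  "valid L \<Longrightarrow> agrees f L \<Longrightarrow> jd e x y \<in> set L \<Longrightarrow> Phi e f x y"
proof (induction L arbitrary: e x y)
  case (Cons j L)
  have IH: "jd e x y \<in> set L \<Longrightarrow> Phi e f x y" for e x y
    using Cons.IH Cons.prems by (auto simp: agrees_def)
  show ?case
  proof (cases "jd e x y \<in> set L")
    case False
    then have "j = jd e x y" using Cons.prems by auto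
    then have "step_ok L e x y" "e = 4 \<Longrightarrow> f x = y"
      using Cons.prems by (auto simp: jd_def agrees_def)
    then show ?thesis using step_ok_sound IH by blast
  qed (rule IH)
qed simp

text \<open>The list occurs only positively in \<open>step_ok\<close>; this is why derivations of
  several premises can be concatenated.\<close>

lemma step_ok_mono:
  assumes "step_ok L e x y" "set L \<subseteq> set L'" shows "step_ok L' e x y"
proof -
  have *: "j \<in> set L \<Longrightarrow> j \<in> set L'" for j using assms(2) by blast
  show ?thesis
    using assms(1) unfolding step_ok_def Let_def by (elim disjE) (blast dest: *)+
qed

lemma valid_append: "valid L \<Longrightarrow> valid M \<Longrightarrow> valid (L @ M)"
  by (induction L) (auto elim: step_ok_mono)

lemma agrees_append: "agrees f (L @ M) \<longleftrightarrow> agrees f L \<and> agrees f M"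
  by (auto simp: agrees_def)

lemma index_payload:
  "(4 * k + 5 - 5) div 4 = (k::nat)" "(4 * k + 6 - 5) div 4 = (k::nat)"
  "(4 * k + 7 - 5) div 4 = (k::nat)" "(4 * k + 8 - 5) div 4 = (k::nat)"
  by simp_all

lemma step_ok_intros:
  "step_ok L 0 x 0" "step_ok L (Suc 0) x (Suc x)" "step_ok L 2 x (pfst x)" "step_ok L 3 x (psnd x)"
  "step_ok L 4 x y"
  "jd a x u \<in> set L \<Longrightarrow> jd b x v \<in> set L \<Longrightarrow>
    step_ok L (4 * prod_encode (a, b) + 5) x (prod_encode (u, v))"
  "jd b x u \<in> set L \<Longrightarrow> jd a u y \<in> set L \<Longrightarrow> step_ok L (4 * prod_encode (a, b) + 6) x y"
  "jd a x y \<in> set L \<Longrightarrow> step_ok L (4 * prod_encode (a, b) + 7) (prod_encode (x, 0)) y"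
  "jd (4 * prod_encode (a, b) + 7) (prod_encode (x, n)) u \<in> set L \<Longrightarrow>
    jd b (prod_encode (x, prod_encode (n, u))) y \<in> set L \<Longrightarrow>
    step_ok L (4 * prod_encode (a, b) + 7) (prod_encode (x, Suc n)) y"
  "jd a (prod_encode (x, y)) 0 \<in> set L \<Longrightarrow>
    (\<forall>j<y. \<exists>u. jd a (prod_encode (x, j)) u \<in> set L \<and> u > 0) \<Longrightarrow> step_ok L (4 * a + 8) x y"
  unfolding step_ok_def Let_def index_payload prod_encode_inverse fst_conv snd_conv diff_Suc_1
  by (simp; blast)+

definition derives :: "(nat \<Rightarrow> nat) \<Rightarrow> nat list \<Rightarrow> nat \<Rightarrow> nat \<Rightarrow> nat \<Rightarrow> bool" where
  "derives f L e x y \<longleftrightarrow> valid L \<and> agrees f L \<and> jd e x y \<in> set L"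

lemma derives_Cons:
  "valid L \<Longrightarrow> agrees f L \<Longrightarrow> step_ok L e x y \<Longrightarrow> (e = 4 \<Longrightarrow> f x = y) \<Longrightarrow>
   derives f (jd e x y # L) e x y"
  by (auto simp: derives_def agrees_def jd_def)

lemma derives_if_eval: "eval f p x y \<Longrightarrow> \<exists>L. derives f L (prog_index p) x y"
proof (induction rule: eval.induct)
  case (eval_Tuple p x y q z)
  then obtain L M where "derives f L (prog_index p) x y" "derives f M (prog_index q) x z" by blast
  then have "derives f (jd (prog_index (Tuple p q)) x (prod_encode (y, z)) # L @ M)
      (prog_index (Tuple p q)) x (prod_encode (y, z))"
    by (intro derives_Cons)
      (auto simp: derives_def agrees_append intro: valid_append step_ok_intros)
  then show ?case by blast
next
  case (eval_Comp q x y p z)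
  then obtain L M where "derives f L (prog_index q) x y" "derives f M (prog_index p) y z" by blast
  then have "derives f (jd (prog_index (Comp p q)) x z # L @ M) (prog_index (Comp p q)) x z"
    by (intro derives_Cons)
      (auto simp: derives_def agrees_append intro: valid_append step_ok_intros(7)[of _ _ y])
  then show ?case by blast
next
  case (eval_PrimRec_0 p x y q)
  then obtain L where "derives f L (prog_index p) x y" by blast
  then have "derives f (jd (prog_index (PrimRec p q)) (prod_encode (x, 0)) y # L)
      (prog_index (PrimRec p q)) (prod_encode (x, 0)) y"
    by (intro derives_Cons) (auto simp: derives_def intro: step_ok_intros)
  then show ?case by blast
next
  case (eval_PrimRec_Suc p q x k y z)
  then obtain L M where "derives f L (prog_index (PrimRec p q)) (prod_encode (x, k)) y"
    "derives f M (prog_index q) (prod_encode (x, prod_encode (k, y))) z" by blast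
  then have "derives f (jd (prog_index (PrimRec p q)) (prod_encode (x, Suc k)) z # L @ M)
      (prog_index (PrimRec p q)) (prod_encode (x, Suc k)) z"
    by (intro derives_Cons)
      (auto simp: derives_def agrees_append intro: valid_append step_ok_intros(9)[of _ _ _ _ y])
  then show ?case by blast
next
  case (eval_Mu p x k)
  obtain M where M: "derives f M (prog_index p) (prod_encode (x, k)) 0"
    using eval_Mu by blast
  \<comment> \<open>Minimisation has a premise for every \<open>j < k\<close>; the corresponding
    derivations are collected in a single list by induction on \<open>n\<close>.\<close>
  have "n \<le> k \<Longrightarrow> \<exists>L. valid L \<and> agrees f L \<and>
      (\<forall>j<n. \<exists>u. jd (prog_index p) (prod_encode (x, j)) u \<in> set L \<and> u > 0)" for n
  proof (induction n)
    case 0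
    show ?case by (intro exI[of _ "[]"]) (simp add: agrees_def)
  next
    case (Suc n)
    then obtain L where "valid L" "agrees f L"
      "\<forall>j<n. \<exists>u. jd (prog_index p) (prod_encode (x, j)) u \<in> set L \<and> u > 0"
      by auto
    moreover obtain u K where "u > 0" "derives f K (prog_index p) (prod_encode (x, n)) u"
      using eval_Mu Suc.prems by (metis Suc_le_lessD)
    ultimately show ?case
      by (intro exI[of _ "L @ K"])
        (auto simp: derives_def agrees_append less_Suc_eq intro: valid_append)
  qed
  then obtain L where L: "valid L" "agrees f L"
      "\<forall>j<k. \<exists>u. jd (prog_index p) (prod_encode (x, j)) u \<in> set L \<and> u > 0"
    by blast
  have "jd (prog_index p) (prod_encode (x, k)) 0 \<in> set (L @ M)"
    using M by (simp add: derives_def)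
  moreover have "\<forall>j<k. \<exists>u. jd (prog_index p) (prod_encode (x, j)) u \<in> set (L @ M) \<and> u > 0"
    using L(3) by (metis UnCI set_append)
  ultimately have "step_ok (L @ M) (prog_index (Mu p)) x k"
    unfolding prog_index.simps by (rule step_ok_intros(10))
  with L M have "derives f (jd (prog_index (Mu p)) x k # L @ M) (prog_index (Mu p)) x k"
    by (intro derives_Cons) (auto simp: derives_def agrees_append intro: valid_append)
  then show ?case by blast
qed (auto intro!: exI derives_Cons[of "[]"] simp: agrees_def intro: step_ok_intros)

text \<open>Kleene's normal form: convergence is an existential quantifier over a relation that is
  decidable in the oracle, by \<open>dec_derives\<close>.\<close>

theorem normal_form: "Phi e f x y \<longleftrightarrow> (\<exists>c. derives f (list_decode c) e x y)"
proof
  assume "Phi e f x y"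
  then obtain L where "derives f L e x y"
    using derives_if_eval[of f "inv prog_index e"] by (auto simp: Phi_def)
  then show "\<exists>c. derives f (list_decode c) e x y"
    by (intro exI[of _ "list_encode L"]) simp
qed (auto simp: derives_def intro: valid_sound)

lemma dec_derives:
  assumes "eff C" "eff E" "eff X" "eff Y"
  shows "dec (\<lambda>f x. derives f (list_decode (C f x)) (E f x) (X f x) (Y f x))"
  unfolding derives_def by (intro assms dec_intros dec_valid dec_agrees dec_mem_jd)

lemma Phi_det: "Phi e f x y \<Longrightarrow> Phi e f x z \<Longrightarrow> y = z"
  unfolding Phi_def by (rule eval_det)

text \<open>Search for a pair of derivation and output, then project to the output. The least such
  pair may differ from the given one, but determinism forces the same output.\<close>

lemma universal: "\<exists>u. \<forall>e f x y. Phi e f x y \<longrightarrow> eval f u (prod_encode (e, x)) y"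
proof -
  have "dec (\<lambda>f z. derives f (list_decode (pfst (psnd z))) (pfst (pfst z)) (psnd (pfst z))
      (psnd (psnd z)))"
    by (intro dec_derives eff_intros)
  from search[of "\<lambda>f x n. derives f (list_decode (pfst n)) (pfst x) (psnd x) (psnd n)", OF this]
  obtain p where p: "\<And>f x. \<exists>n. derives f (list_decode (pfst n)) (pfst x) (psnd x) (psnd n) \<Longrightarrow>
      eval f p x (LEAST n. derives f (list_decode (pfst n)) (pfst x) (psnd x) (psnd n))"
    by blast
  have "eval f (Comp PSnd p) (prod_encode (e, x)) y" if Phi: "Phi e f x y" for e f x y
  proof -
    let ?R = "\<lambda>n. derives f (list_decode (pfst n)) e x (psnd n)"
    obtain c where "derives f (list_decode c) e x y" using Phi normal_form by blast
    then have "?R (prod_encode (c, y))" by simp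
    then have ex: "\<exists>n. ?R n" ..
    then have "Phi e f x (psnd (LEAST n. ?R n))"
      unfolding normal_form using LeastI_ex[OF ex] by blast
    then have "psnd (LEAST n. ?R n) = y" using Phi Phi_det by blast
    then show ?thesis
      using eval_Comp[OF p[of f "prod_encode (e, x)"] eval_PSnd] ex by simp
  qed
  then show ?thesis by blast
qed

section \<open>Effective manipulation of indices\<close>

lemma eff_const_prog: "eff (\<lambda>f x. prog_index (const_prog x))"
proof -
  have eq: "rec_nat 0 (\<lambda>_ y. 4 * prod_encode (1, y) + 6) n = prog_index (const_prog n)" for n
    by (induction n) auto
  have "eff (\<lambda>f x. rec_nat 0 (\<lambda>_ y. 4 * prod_encode (1, y) + 6) x)"
    by (intro eff_rec eff_intros)
  then show ?thesis by (simp only: eq)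
qed

text \<open>The s-m-n theorem: the first argument is hardwired as a constant program, whose index
  depends effectively on the constant.\<close>

lemma smn:
  "\<exists>s. eff (\<lambda>_. s) \<and> (\<forall>n f x y. eval f p (prod_encode (n, x)) y \<longrightarrow> Phi (s n) f x y)"
proof -
  define s where "s n = prog_index (Comp p (Tuple (const_prog n) (Tuple PFst PSnd)))" for n
  have "eff (\<lambda>f x. s x)"
    unfolding s_def prog_index.simps by (intro eff_intros eff_const_prog)
  moreover have "Phi (s n) f x y" if "eval f p (prod_encode (n, x)) y" for n f x y
    unfolding s_def Phi_index by (rule eval_Comp[OF eval_Tuple[OF eval_const eval_id] that])
  ultimately show ?thesis by blast
qed

section \<open>Composition of Turing functionals by substitution for oracle calls\<close>

primrec psub :: "prog \<Rightarrow> prog \<Rightarrow> prog" where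
  "psub r Zero = Zero"
| "psub r Succ = Succ"
| "psub r PFst = PFst"
| "psub r PSnd = PSnd"
| "psub r Query = r"
| "psub r (Tuple p q) = Tuple (psub r p) (psub r q)"
| "psub r (Comp p q) = Comp (psub r p) (psub r q)"
| "psub r (PrimRec p q) = PrimRec (psub r p) (psub r q)"
| "psub r (Mu p) = Mu (psub r p)"

text \<open>If \<open>r\<close> computes \<open>g\<close> from \<open>f\<close>, answering queries
  by running \<open>r\<close> turns a computation from \<open>g\<close> into one from
  \<open>f\<close>.\<close>

lemma eval_psub:
  assumes r: "\<And>x. eval f r x (g x)"
  shows "eval g p x y \<Longrightarrow> eval f (psub r p) x y"
proof (induction rule: eval.induct)
  case (eval_Mu p x k)
  then show ?case by (auto intro: eval.eval_Mu)
qed (auto simp: r intro: eval.intros)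

text \<open>With \<open>p\<close> fixed, the index of the result is a fixed arithmetic expression in
  the index \<open>a\<close> of the substituted program; hence induction on
  \<open>p\<close>.\<close>

lemma eff_psub: "eff (\<lambda>f a. prog_index (psub (inv prog_index a) p))"
  by (induction p) (auto intro!: eff_intros)

text \<open>Substituting \<open>Zero\<close> for the oracle calls runs the functional on the zero
  function, whatever the actual oracle is.\<close>

lemma eff_fixed_oracle: assumes "eff F" shows "eff (\<lambda>_. F (\<lambda>_. 0))"
proof -
  obtain p where p: "\<And>f x. eval f p x (F f x)" using assms unfolding eff_def by blast
  have "eval f (psub Zero p) x (F (\<lambda>_. 0) x)" for f x
    by (rule eval_psub[OF eval_Zero p])
  then show ?thesis unfolding eff_def by blast
qed

lemma computable_iff_eff: "computable h \<longleftrightarrow> eff (\<lambda>_. h)"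
proof
  assume "computable h"
  then obtain p where p: "\<And>x. eval (\<lambda>_. 0) p x (h x)"
    unfolding computable_def computes_def Phi_def by blast
  have "eval f (psub Zero p) x (h x)" for f x
    by (rule eval_psub[OF eval_Zero p])
  then show "eff (\<lambda>_. h)" unfolding eff_def by blast
next
  assume "eff (\<lambda>_. h)"
  then obtain p where "\<And>f x. eval f p x (h x)" unfolding eff_def by blast
  then show "computable h"
    unfolding computable_def computes_def by (metis Phi_index)
qed

lemma eff_index: assumes "eff F" shows "\<exists>e. \<forall>f x. Phi e f x (F f x)"
  using assms unfolding eff_def by (metis Phi_index)

text \<open>Effectivity in both indices is needed, but \<open>eff_psub\<close> varies only the
  substituted program. The outer program is therefore the fixed universal one, and \<open>e\<close>
  enters as a hardwired argument.\<close>

lemma index_comp: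
  obtains c where "eff (\<lambda>_. c)" "\<And>e a f g x y.
    (\<And>x. Phi a f x (g x)) \<Longrightarrow> Phi e g x y \<Longrightarrow> Phi (c (prod_encode (e, a))) f x y"
proof -
  obtain u where u: "\<And>e f x y. Phi e f x y \<Longrightarrow> eval f u (prod_encode (e, x)) y"
    using universal by blast
  have "eff (\<lambda>f n. prog_index (Comp (psub (inv prog_index (psnd n)) u)
      (Tuple (const_prog (pfst n)) (Tuple PFst PSnd))))" (is "eff (\<lambda>f n. ?h n)")
    unfolding prog_index.simps
    by (intro eff_intros eff_comp[OF eff_psub] eff_comp[OF eff_const_prog])
  moreover have "Phi (?h (prod_encode (e, a))) f x y"
    if Phi: "\<And>x. Phi a f x (g x)" "Phi e g x y" for e a f g x y
  proof -
    have "eval f (psub (inv prog_index a) u) (prod_encode (e, x)) y"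
      using Phi unfolding Phi_def by (intro eval_psub[of f _ g] u[unfolded Phi_def]) auto
    then show ?thesis
      unfolding prod_encode_inverse fst_conv snd_conv Phi_index
      by (rule eval_Comp[OF eval_Tuple[OF eval_const eval_id]])
  qed
  ultimately show ?thesis by (rule that)
qed

section \<open>Effective Borel classes\<close>

lemma Pi_class_0:
  "Pi_class 0 (3 * m) =
    {f. \<forall>i<length (list_decode m). f i = nth0 (list_decode m) i}" (is ?Cyl)
  "Pi_class 0 (3 * m + 1) = - Pi_class 0 m" (is ?Neg)
  "Pi_class 0 (3 * m + 2) = Pi_class 0 (pfst m) \<inter> Pi_class 0 (psnd m)" (is ?Conj)
proof -
  have inv_index [simp]: "inv bcomb_index (bcomb_index b) = b"
    and index_inv [simp]: "bcomb_index (inv bcomb_index e) = e" for b e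
    using bij_bcomb_index by (simp_all add: bij_is_inj bij_is_surj surj_f_inv_f)
  have "3 * m = bcomb_index (Cyl (list_decode m))"
    "3 * m + 1 = bcomb_index (Neg (inv bcomb_index m))"
    "3 * m + 2 = bcomb_index (Conj (inv bcomb_index (pfst m)) (inv bcomb_index (psnd m)))"
    by simp_all
  then have *: "inv bcomb_index (3 * m) = Cyl (list_decode m)"
    "inv bcomb_index (3 * m + 1) = Neg (inv bcomb_index m)"
    "inv bcomb_index (3 * m + 2) = Conj (inv bcomb_index (pfst m)) (inv bcomb_index (psnd m))"
    by (metis inv_index)+
  show ?Cyl ?Neg ?Conj
    unfolding Pi_class.simps * by (auto simp: nth0_def)
qed

text \<open>One step of a course-of-values recursion: \<open>L\<close> is meant to list the indices
  below \<open>k\<close> of clopen classes containing \<open>f\<close>. This suffices because the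
  components of a Boolean combination have smaller indices.\<close>

definition clopen_step :: "(nat \<Rightarrow> nat) \<Rightarrow> nat \<Rightarrow> nat list \<Rightarrow> bool" where
  "clopen_step f k L \<longleftrightarrow>
    (let m = k div 3 in
      k = 3 * m \<and> (\<forall>i<length (list_decode m). f i = nth0 (list_decode m) i) \<or>
      k = 3 * m + 1 \<and> m \<notin> set L \<or>
      k = 3 * m + 2 \<and> pfst m \<in> set L \<and> psnd m \<in> set L)"

lemma clopen_step_iff:
  assumes "set L = {c. c < k \<and> f \<in> Pi_class 0 c}"
  shows "clopen_step f k L \<longleftrightarrow> f \<in> Pi_class 0 k"
proof -
  define m where "m = k div 3"
  consider "k = 3 * m" | "k = 3 * m + 1" | "k = 3 * m + 2" unfolding m_def by linarith
  then show ?thesis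
  proof cases
    case 1
    have "clopen_step f k L \<longleftrightarrow> (\<forall>i<length (list_decode m). f i = nth0 (list_decode m) i)"
      unfolding clopen_step_def Let_def m_def[symmetric] using 1 by simp
    then show ?thesis unfolding 1 Pi_class_0 by simp
  next
    case 2
    then have "m < k" by simp
    moreover have "clopen_step f k L \<longleftrightarrow> m \<notin> set L"
      unfolding clopen_step_def Let_def m_def[symmetric] using 2 by simp
    ultimately show ?thesis unfolding 2 Pi_class_0 using assms 2 by simp
  next
    case 3
    have "pfst m \<le> m" "psnd m \<le> m"
      by (metis le_prod_encode_1 le_prod_encode_2 prod.collapse prod_decode_inverse)+
    then have "pfst m < k" "psnd m < k" using 3 by simp_all
    moreover have "clopen_step f k L \<longleftrightarrow> pfst m \<in> set L \<and> psnd m \<in> set L"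
      unfolding clopen_step_def Let_def m_def[symmetric] using 3 by simp
    ultimately show ?thesis unfolding 3 Pi_class_0 using assms 3 by simp
  qed
qed

lemma dec_clopen_step:
  assumes "eff K" "eff C" shows "dec (\<lambda>f x. clopen_step f (K f x) (list_decode (C f x)))"
  unfolding clopen_step_def Let_def
  by (intro assms eff_comp[of K] eff_comp[of C] dec_intros dec_mem eff_intros eff_list_intros
      eff_div; simp)

lemma dec_clopen:
  assumes "eff F" shows "dec (\<lambda>f x. f \<in> Pi_class 0 (F f x))"
proof -
  \<comment> \<open>\<open>T f n\<close> codes the list of all indices below \<open>n\<close> whose
    class contains \<open>f\<close>; \<open>Suc (prod_encode (k, t))\<close> is the code of the list
    with \<open>k\<close> put in front.\<close>
  define T where "T f n = rec_nat 0
    (\<lambda>k t. if clopen_step f k (list_decode t) then Suc (prod_encode (k, t)) else t) n"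
    for f :: "nat \<Rightarrow> nat" and n :: nat
  have T: "set (list_decode (T f n)) = {c. c < n \<and> f \<in> Pi_class 0 c}" for f n
  proof (induction n)
    case (Suc n)
    have T_Suc: "T f (Suc n) = (if clopen_step f n (list_decode (T f n))
        then Suc (prod_encode (n, T f n)) else T f n)"
      by (simp add: T_def)
    show ?case
      unfolding T_Suc clopen_step_iff[OF Suc] using Suc by (auto simp: less_Suc_eq)
  qed (simp add: T_def)
  have "eff (\<lambda>f x. T f (F f x))"
    unfolding T_def by (intro assms eff_rec eff_if dec_clopen_step eff_intros)
  then have "dec (\<lambda>f x. clopen_step f (F f x) (list_decode (T f (F f x))))"
    by (intro dec_clopen_step assms)
  then show ?thesis by (simp add: clopen_step_iff[OF T])
qed

section \<open>Closure properties of uniformly effective sequences of classes\<close>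

lemma uniformly_Pi_iff: "uniformly_Pi k V \<longleftrightarrow> (\<exists>h. eff (\<lambda>_. h) \<and> (\<forall>i. V i = Pi_class k (h i)))"
  by (simp add: uniformly_Pi_def computable_iff_eff)

lemma uniformly_Pi_reindex:
  assumes "uniformly_Pi k V" "eff (\<lambda>_. h)" shows "uniformly_Pi k (\<lambda>i. V (h i))"
proof -
  obtain g where "eff (\<lambda>_. g)" "\<And>i. V i = Pi_class k (g i)"
    using assms(1) uniformly_Pi_iff by auto
  then show ?thesis
    unfolding uniformly_Pi_iff using eff_comp[of "\<lambda>_. g", OF _ assms(2)] by auto
qed

lemma uniformly_Pi_if:
  assumes "uniformly_Pi k V" "uniformly_Pi k W" "dec (\<lambda>_. P)"
  shows "uniformly_Pi k (\<lambda>i. if P i then V i else W i)"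
proof -
  obtain g h where "eff (\<lambda>_. g)" "\<And>i. V i = Pi_class k (g i)"
    "eff (\<lambda>_. h)" "\<And>i. W i = Pi_class k (h i)"
    using assms(1,2) uniformly_Pi_iff by auto
  then show ?thesis
    unfolding uniformly_Pi_iff using eff_if[OF assms(3)]
    by (intro exI[of _ "\<lambda>i. if P i then g i else h i"]) auto
qed

text \<open>By s-m-n, an index \<open>s i\<close> for the sequence of all
  \<open>h (prod_encode (i, j))\<close> is found effectively from \<open>i\<close>. With the
  converse \<open>uniformly_Pi_SucE\<close>, partial listings can be replaced by total double
  sequences.\<close>

lemma uniformly_Pi_SucI:
  assumes "uniformly_Pi k W" "\<And>i. V i = (\<Inter>j. - W (prod_encode (i, j)))"
  shows "uniformly_Pi (Suc k) V"
proof -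
  obtain h where h: "eff (\<lambda>_. h)" "\<And>i. W i = Pi_class k (h i)"
    using assms(1) uniformly_Pi_iff by auto
  then obtain p where p: "\<And>f x. eval f p x (h x)" unfolding eff_def by blast
  obtain s where s: "eff (\<lambda>_. s)"
    "\<And>n f x y. eval f p (prod_encode (n, x)) y \<Longrightarrow> Phi (s n) f x y"
    using smn[of p] by blast
  have "Phi (s i) f j m \<longleftrightarrow> m = h (prod_encode (i, j))" for i f j m
    using s(2)[OF p] Phi_det by blast
  then have "V i = Pi_class (Suc k) (s i)" for i
    by (simp add: assms(2) h(2) set_eq_iff)
  then show ?thesis unfolding uniformly_Pi_iff using s(1) by blast
qed

text \<open>Passing to the next level complements, which swaps the full and the empty class, so both
  are handled in one induction.\<close>

lemma uniformly_Pi_trivial: "uniformly_Pi k (\<lambda>_. UNIV) \<and> uniformly_Pi k (\<lambda>_. {})"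
proof (induction k)
  case 0
  have "Pi_class 0 0 = UNIV" using Pi_class_0(1)[of 0] by simp
  moreover have "Pi_class 0 1 = {}" using Pi_class_0(2)[of 0] calculation by simp
  ultimately show ?case
    unfolding uniformly_Pi_iff
    by (intro conjI exI[of _ "\<lambda>_. 0"] exI[of _ "\<lambda>_. 1"] eff_const) simp_all
next
  case (Suc k)
  then show ?case
    by (auto intro: uniformly_Pi_SucI[of k "\<lambda>_. UNIV"] uniformly_Pi_SucI[of k "\<lambda>_. {}"])
qed

lemmas uniformly_Pi_UNIV = uniformly_Pi_trivial[THEN conjunct1]
  and uniformly_Pi_empty = uniformly_Pi_trivial[THEN conjunct2]

text \<open>Entries of the partial listing are looked up together with a derivation, so that missing
  ones can be replaced by the empty class and the listing becomes total.\<close>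

lemma uniformly_Pi_SucE:
  assumes "uniformly_Pi (Suc k) V"
  obtains W where "uniformly_Pi k W" "\<And>i. V i = (\<Inter>j. - W (prod_encode (i, j)))"
proof -
  obtain h where h: "eff (\<lambda>_. h)" "\<And>i. V i = Pi_class (Suc k) (h i)"
    using assms uniformly_Pi_iff by auto
  \<comment> \<open>Here \<open>z\<close> codes \<open>(i, (c, (a, m)))\<close>: the derivation
    \<open>c\<close> certifies that the listing with index \<open>h i\<close> has entry
    \<open>m\<close> at place \<open>a\<close>.\<close>
  define P where "P z \<longleftrightarrow> derives (\<lambda>_. 0) (list_decode (pfst (psnd z))) (h (pfst z))
      (pfst (psnd (psnd z))) (psnd (psnd (psnd z)))" for z
  have "dec (\<lambda>f z. derives f (list_decode (pfst (psnd z))) (h (pfst z))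
      (pfst (psnd (psnd z))) (psnd (psnd (psnd z))))"
    by (intro dec_derives eff_comp[OF h(1)] eff_intros)
  then have "dec (\<lambda>_. P)"
    unfolding P_def dec_def by (rule eff_fixed_oracle)
  moreover have "uniformly_Pi k (\<lambda>z. Pi_class k (psnd (psnd (psnd z))))"
    unfolding uniformly_Pi_iff by (intro exI[of _ "\<lambda>z. psnd (psnd (psnd z))"] conjI eff_intros) simp
  ultimately have
    "uniformly_Pi k (\<lambda>z. if P z then Pi_class k (psnd (psnd (psnd z))) else {})"
    by (intro uniformly_Pi_if uniformly_Pi_empty)
  moreover have "f \<in> V i \<longleftrightarrow> (\<forall>j. f \<notin> (if P (prod_encode (i, j))
      then Pi_class k (psnd (psnd (psnd (prod_encode (i, j))))) else {}))" for f i
  proof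
    assume "f \<in> V i"
    then show "\<forall>j. f \<notin> (if P (prod_encode (i, j))
        then Pi_class k (psnd (psnd (psnd (prod_encode (i, j))))) else {})"
      unfolding P_def using normal_form by (auto simp: h(2))
  next
    assume *: "\<forall>j. f \<notin> (if P (prod_encode (i, j))
        then Pi_class k (psnd (psnd (psnd (prod_encode (i, j))))) else {})"
    have "f \<notin> Pi_class k m" if "Phi (h i) (\<lambda>_. 0) a m" for a m
    proof -
      obtain c where "derives (\<lambda>_. 0) (list_decode c) (h i) a m"
        using normal_form \<open>Phi (h i) (\<lambda>_. 0) a m\<close> by blast
      then show ?thesis
        using *[rule_format, of "prod_encode (c, prod_encode (a, m))"] by (simp add: P_def)
    qed
    then show "f \<in> V i" by (simp add: h(2))
  qed
  ultimately show ?thesis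
    by (intro that[of "\<lambda>z. if P z then Pi_class k (psnd (psnd (psnd z))) else {}"]) auto
qed

lemma uniformly_Pi_Int:
  assumes "uniformly_Pi k V" "uniformly_Pi k W" shows "uniformly_Pi k (\<lambda>i. V i \<inter> W i)"
proof (cases k)
  case 0
  then obtain g h where gh: "eff (\<lambda>_. g)" "\<And>i. V i = Pi_class 0 (g i)"
    "eff (\<lambda>_. h)" "\<And>i. W i = Pi_class 0 (h i)"
    using assms uniformly_Pi_iff by auto
  have "V i \<inter> W i = Pi_class 0 (3 * prod_encode (g i, h i) + 2)" for i
    unfolding Pi_class_0 by (simp add: gh)
  moreover have "eff (\<lambda>_ i. 3 * prod_encode (g i, h i) + 2)"
    by (intro gh eff_intros)
  ultimately show ?thesis unfolding uniformly_Pi_iff 0 by blast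
next
  case (Suc l)
  obtain V' where V': "uniformly_Pi l V'" "\<And>i. V i = (\<Inter>j. - V' (prod_encode (i, j)))"
    using assms(1) uniformly_Pi_SucE unfolding Suc by blast
  obtain W' where W': "uniformly_Pi l W'" "\<And>i. W i = (\<Inter>j. - W' (prod_encode (i, j)))"
    using assms(2) uniformly_Pi_SucE unfolding Suc by blast
  have h: "eff (\<lambda>_ z. prod_encode (pfst z, psnd z div 2))"
    by (intro eff_intros eff_div) simp
  \<comment> \<open>The two listings are interleaved, \<open>V'\<close> at even and
    \<open>W'\<close> at odd places.\<close>
  let ?U = "\<lambda>z. if psnd z = 2 * (psnd z div 2) then V' (prod_encode (pfst z, psnd z div 2))
    else W' (prod_encode (pfst z, psnd z div 2))"
  have "uniformly_Pi l ?U"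
    by (intro uniformly_Pi_if uniformly_Pi_reindex[OF V'(1) h] uniformly_Pi_reindex[OF W'(1) h]
        dec_intros eff_intros eff_div) simp
  moreover have "f \<in> V i \<inter> W i \<longleftrightarrow> (\<forall>j. f \<notin> ?U (prod_encode (i, j)))" for f i
  proof
    assume *: "\<forall>j. f \<notin> ?U (prod_encode (i, j))"
    have "f \<notin> V' (prod_encode (i, j))" "f \<notin> W' (prod_encode (i, j))" for j
      using *[rule_format, of "2 * j"] *[rule_format, of "2 * j + 1"] by simp_all
    then show "f \<in> V i \<inter> W i" by (simp add: V'(2) W'(2))
  qed (auto simp: V'(2) W'(2))
  ultimately show ?thesis
    unfolding Suc by (intro uniformly_Pi_SucI[of l ?U]) auto
qed

text \<open>Clopen classes are closed under complement, so at level 0 a constant listing of the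
  complement works; at higher levels the listing itself is raised by induction.\<close>

lemma uniformly_Pi_mono_Suc: "uniformly_Pi k V \<Longrightarrow> uniformly_Pi (Suc k) V"
proof (induction k arbitrary: V)
  case 0
  then obtain h where h: "eff (\<lambda>_. h)" "\<And>i. V i = Pi_class 0 (h i)"
    using uniformly_Pi_iff by auto
  have "- V (pfst z) = Pi_class 0 (3 * h (pfst z) + 1)" for z
    unfolding Pi_class_0 by (simp add: h)
  moreover have "eff (\<lambda>_ z. 3 * h (pfst z) + 1)"
    by (intro eff_intros eff_comp[OF h(1)])
  ultimately have "uniformly_Pi 0 (\<lambda>z. - V (pfst z))" unfolding uniformly_Pi_iff by blast
  then show ?case by (rule uniformly_Pi_SucI) simp
next
  case (Suc k)
  then obtain W where "uniformly_Pi k W" "\<And>i. V i = (\<Inter>j. - W (prod_encode (i, j)))"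
    using uniformly_Pi_SucE by blast
  then show ?case using Suc.IH uniformly_Pi_SucI by blast
qed

lemma uniformly_Pi_mono: "k \<le> l \<Longrightarrow> uniformly_Pi k V \<Longrightarrow> uniformly_Pi l V"
  by (induction l rule: dec_induct) (auto intro: uniformly_Pi_mono_Suc)

section \<open>The use principle and preimages under partial functionals\<close>

lemma agrees_fin_imp_agrees:
  "agrees_fin s L \<Longrightarrow> (\<And>i. i < length s \<Longrightarrow> f i = nth0 s i) \<Longrightarrow> agrees f L"
  by (auto simp: agrees_fin_def agrees_def)

lemma agrees_imp_agrees_fin:
  assumes "agrees f L" shows "\<exists>n. agrees_fin (map f [0..<n]) L"
proof -
  have "pfst (psnd j) < list_encode L" if "j \<in> set L" for j
  proof -
    have "pfst (psnd j) \<le> j"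
      by (metis le_prod_encode_1 le_prod_encode_2 order_trans prod.collapse prod_decode_inverse)
    then show ?thesis using mem_less_code[OF that] by simp
  qed
  then have "agrees_fin (map f [0..<list_encode L]) L"
    using assms by (auto simp: agrees_fin_def agrees_def nth0_def)
  then show ?thesis ..
qed

text \<open>A positive answer to \<open>R\<close> depends on a finite part of the oracle, so the
  complement is a union of cylinders that can be listed effectively.\<close>

lemma uniformly_Pi_1I:
  assumes "dec R" shows "uniformly_Pi 1 (\<lambda>i. {f. \<forall>n. \<not> R f (prod_encode (i, n))})"
proof -
  obtain e where e: "\<And>f x. Phi e f x (if R f x then 0 else 1)"
    using eff_index assms unfolding dec_def by blast
  have R: "R f x \<longleftrightarrow> Phi e f x 0" for f x
    using e[of f x] Phi_det[of e f x] by (auto split: if_splits)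
  \<comment> \<open>Here \<open>z\<close> codes \<open>(i, (n, (c, s)))\<close>: the derivation
    \<open>c\<close> confirms \<open>R\<close> at \<open>(i, n)\<close> using only the oracle
    segment \<open>s\<close>, whose cylinder has index \<open>3 * s\<close>.\<close>
  define P where "P z \<longleftrightarrow>
    valid (list_decode (pfst (psnd (psnd z)))) \<and>
    agrees_fin (list_decode (psnd (psnd (psnd z)))) (list_decode (pfst (psnd (psnd z)))) \<and>
    jd e (prod_encode (pfst z, pfst (psnd z))) 0 \<in> set (list_decode (pfst (psnd (psnd z))))" for z
  have "dec (\<lambda>_. P)"
    unfolding P_def by (intro dec_intros dec_valid dec_agrees_fin dec_mem_jd eff_intros)
  moreover have "uniformly_Pi 0 (\<lambda>z. Pi_class 0 (3 * psnd (psnd (psnd z))))"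
    unfolding uniformly_Pi_iff
    by (intro exI[of _ "\<lambda>z. 3 * psnd (psnd (psnd z))"] conjI eff_intros) simp
  ultimately have "uniformly_Pi 0 (\<lambda>z. if P z then Pi_class 0 (3 * psnd (psnd (psnd z))) else {})"
    (is "uniformly_Pi 0 ?W")
    by (intro uniformly_Pi_if uniformly_Pi_empty)
  moreover have "(\<exists>n. R f (prod_encode (i, n))) \<longleftrightarrow> (\<exists>j. f \<in> ?W (prod_encode (i, j)))" for f i
  proof
    assume "\<exists>n. R f (prod_encode (i, n))"
    then obtain n c where c: "derives f (list_decode c) e (prod_encode (i, n)) 0"
      using R normal_form by blast
    then obtain m where "agrees_fin (map f [0..<m]) (list_decode c)"
      using agrees_imp_agrees_fin by (auto simp: derives_def)
    then have "f \<in> ?W (prod_encode (i, prod_encode (n, prod_encode (c, list_encode (map f [0..<m])))))"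
      using c unfolding Pi_class_0(1) by (simp add: P_def derives_def nth0_def)
    then show "\<exists>j. f \<in> ?W (prod_encode (i, j))" ..
  next
    assume "\<exists>j. f \<in> ?W (prod_encode (i, j))"
    then obtain j where j: "P (prod_encode (i, j))" "f \<in> Pi_class 0 (3 * psnd (psnd j))"
      by (auto split: if_splits)
    then have "derives f (list_decode (pfst (psnd j))) e (prod_encode (i, pfst j)) 0"
      unfolding Pi_class_0(1) by (auto simp: P_def derives_def intro: agrees_fin_imp_agrees)
    then show "\<exists>n. R f (prod_encode (i, n))" using R normal_form by blast
  qed
  ultimately show ?thesis
    unfolding One_nat_def by (intro uniformly_Pi_SucI[of 0 ?W]) auto
qed

text \<open>The preimage is prescribed only where \<open>a\<close> yields a total function. At level
  1 membership means that no search for a counterexample succeeds, so divergence is harmless; higher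
  levels pull back the listing.\<close>

lemma uniformly_Pi_preimage:
  "uniformly_Pi (Suc k) V \<Longrightarrow> \<exists>V'. uniformly_Pi (Suc k) V' \<and>
    (\<forall>i a f g. (\<forall>x. Phi a f x (g x)) \<longrightarrow> (f \<in> V' (prod_encode (i, a)) \<longleftrightarrow> g \<in> V i))"
proof (induction k arbitrary: V)
  case 0
  then obtain W where W: "uniformly_Pi 0 W" "\<And>i. V i = (\<Inter>j. - W (prod_encode (i, j)))"
    using uniformly_Pi_SucE by blast
  then obtain h where h: "eff (\<lambda>_. h)" "\<And>i. W i = Pi_class 0 (h i)"
    using uniformly_Pi_iff by auto
  obtain b where b: "\<And>f x. eval f b x (if f \<in> Pi_class 0 x then 0 else 1)"
    using dec_clopen[OF eff_id] unfolding dec_def eff_def by blast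
  \<comment> \<open>Here \<open>z\<close> codes \<open>((i, a), (j, c))\<close>: \<open>c\<close>
    derives the answer 0, that is "yes", of the clopen membership test for
    \<open>W (prod_encode (i, j))\<close> with its queries answered by index \<open>a\<close> run on
    \<open>f\<close>.\<close>
  define R where "R f z \<longleftrightarrow> derives f (list_decode (psnd (psnd z)))
    (prog_index (psub (inv prog_index (psnd (pfst z))) b))
    (h (prod_encode (pfst (pfst z), pfst (psnd z)))) 0" for f z
  have "dec R"
    unfolding R_def
    by (intro dec_derives eff_comp[OF eff_psub] eff_comp[OF h(1)] eff_intros)
  then have "uniformly_Pi (Suc 0) (\<lambda>i. {f. \<forall>n. \<not> R f (prod_encode (i, n))})"
    using uniformly_Pi_1I by simp
  moreover have "f \<in> {f. \<forall>n. \<not> R f (prod_encode (prod_encode (i, a), n))} \<longleftrightarrow> g \<in> V i"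
    if Phi: "\<forall>x. Phi a f x (g x)" for i a f g
  proof -
    have "eval f (psub (inv prog_index a) b) x (if g \<in> Pi_class 0 x then 0 else 1)" for x
      using Phi by (intro eval_psub[OF _ b]) (simp add: Phi_def)
    then have "eval f (psub (inv prog_index a) b) x 0 \<longleftrightarrow> g \<in> Pi_class 0 x" for x
      using eval_det[of f "psub (inv prog_index a) b" x] by (metis zero_neq_one)
    then have ex: "(\<exists>c. derives f (list_decode c) (prog_index (psub (inv prog_index a) b)) x 0)
        \<longleftrightarrow> g \<in> Pi_class 0 x" for x
      using normal_form[symmetric] by simp
    have "(\<exists>n. R f (prod_encode (prod_encode (i, a), n))) \<longleftrightarrow>
        (\<exists>j c. R f (prod_encode (prod_encode (i, a), prod_encode (j, c))))"
      by (metis prod_decode_inverse surj_pair)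
    also have "\<dots> \<longleftrightarrow> (\<exists>j. g \<in> W (prod_encode (i, j)))"
      unfolding R_def h(2) by (simp add: ex)
    finally show ?thesis using W(2) by auto
  qed
  ultimately show ?case by blast
next
  case (Suc k)
  obtain W where W: "uniformly_Pi (Suc k) W" "\<And>i. V i = (\<Inter>j. - W (prod_encode (i, j)))"
    using uniformly_Pi_SucE[OF Suc.prems] by blast
  obtain W' where W': "uniformly_Pi (Suc k) W'" "\<And>i a f g. (\<forall>x. Phi a f x (g x)) \<Longrightarrow>
      f \<in> W' (prod_encode (i, a)) \<longleftrightarrow> g \<in> W i"
    using Suc.IH[OF W(1)] by (elim exE conjE) simp
  let ?h = "\<lambda>z. prod_encode (prod_encode (pfst (pfst z), psnd z), psnd (pfst z))"
  have "uniformly_Pi (Suc k) (\<lambda>z. W' (?h z))"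
    by (rule uniformly_Pi_reindex[OF W'(1)]) (intro eff_intros)
  then have "uniformly_Pi (Suc (Suc k)) (\<lambda>z. \<Inter>j. - W' (?h (prod_encode (z, j))))"
    by (rule uniformly_Pi_SucI) simp
  moreover have "f \<in> (\<Inter>j. - W' (?h (prod_encode (prod_encode (i, a), j)))) \<longleftrightarrow> g \<in> V i"
    if "\<forall>x. Phi a f x (g x)" for i a f g
    using W'(2)[OF that] by (simp add: W(2))
  ultimately show ?case by (intro exI[of _ "\<lambda>z. \<Inter>j. - W' (?h (prod_encode (z, j)))"]) blast
qed

section \<open>The reducibilities\<close>

lemma reduc_enat_iff:
  "reduc (enat k) A B \<longleftrightarrow> (\<exists>V e. uniformly_Pi k V \<and> B \<subseteq> (\<Union>i. V i) \<and> eff (\<lambda>_. e) \<and>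
    (\<forall>i. \<forall>f \<in> B \<inter> V i. Phi_in (e i) f A))"
  by (simp add: reduc_def computable_iff_eff)

lemma reduc_enatI:
  assumes "uniformly_Pi k V" "eff (\<lambda>_. e)" "\<And>f. f \<in> B \<Longrightarrow> \<exists>i. f \<in> V i"
    "\<And>i f. f \<in> B \<Longrightarrow> f \<in> V i \<Longrightarrow> Phi_in (e i) f A"
  shows "reduc (enat k) A B"
  unfolding reduc_enat_iff
  by (intro exI[of _ V] exI[of _ e] conjI assms(1,2)) (use assms(3,4) in auto)

lemma reduc_infinity: "reduc \<infinity> A B \<longleftrightarrow> (\<forall>f\<in>B. \<exists>g\<in>A. computes f g)"
  by (simp add: reduc_def)

lemma Phi_inI: "g \<in> A \<Longrightarrow> (\<And>x. Phi e f x (g x)) \<Longrightarrow> Phi_in e f A"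
  unfolding Phi_in_def by blast

text \<open>One functional for all of \<open>B\<close> gives a reduction at every level, with the
  trivial cover and a constant sequence of indices.\<close>

lemma reduc_single:
  assumes "\<And>f. f \<in> B \<Longrightarrow> Phi_in e f A" shows "reduc n A B"
proof (cases n)
  case (enat k)
  show ?thesis
    unfolding enat
    by (rule reduc_enatI[OF uniformly_Pi_UNIV eff_const[of e]]) (use assms in auto)
next
  case infinity
  have "\<exists>g\<in>A. computes f g" if "f \<in> B" for f
    using assms[OF that] unfolding Phi_in_def computes_def by blast
  then show ?thesis unfolding infinity reduc_infinity by blast
qed

lemma reduc_functional:
  assumes "eff F" "\<And>f. f \<in> B \<Longrightarrow> F f \<in> A" shows "reduc n A B"
proof -
  obtain e where "\<And>f x. Phi e f x (F f x)" using eff_index[OF assms(1)] by blast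
  then show ?thesis using assms(2) by (intro reduc_single[of B e]) (auto intro: Phi_inI)
qed

lemma reduc_refl: "reduc n A A"
  by (rule reduc_functional[of "\<lambda>f x. f x"]) (intro eff_intros, simp)

text \<open>A uniformly clopen cover can be searched, so at level 0 one index suffices
  (Medvedev reducibility).\<close>

lemma reduc_0D:
  assumes "reduc 0 A B" shows "\<exists>e. \<forall>f\<in>B. Phi_in e f A"
proof -
  obtain V e where V: "uniformly_Pi 0 V" "B \<subseteq> (\<Union>i. V i)" and e: "eff (\<lambda>_. e)"
    and in_A: "\<And>i f. f \<in> B \<Longrightarrow> f \<in> V i \<Longrightarrow> Phi_in (e i) f A"
    using assms unfolding zero_enat_def reduc_enat_iff by blast
  obtain h where h: "eff (\<lambda>_. h)" "\<And>i. V i = Pi_class 0 (h i)"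
    using V(1) uniformly_Pi_iff by auto
  have "dec (\<lambda>f z. f \<in> Pi_class 0 (h (psnd z)))"
    by (intro dec_clopen eff_comp[OF h(1)] eff_intros)
  from search[of "\<lambda>f x i. f \<in> Pi_class 0 (h i)", OF this]
  obtain p where p: "\<And>f x. \<exists>i. f \<in> V i \<Longrightarrow> eval f p x (LEAST i. f \<in> V i)"
    unfolding h(2) by blast
  obtain q where q: "\<And>f x. eval f q x (e x)" using e unfolding eff_def by blast
  obtain u where u: "\<And>e f x y. Phi e f x y \<Longrightarrow> eval f u (prod_encode (e, x)) y"
    using universal by blast
  \<comment> \<open>The combined program finds the least \<open>i\<close> with
    \<open>f \<in> V i\<close>, computes \<open>e i\<close> and runs that index through the
    universal program.\<close>
  have "Phi_in (prog_index (Comp u (Tuple (Comp q p) (Tuple PFst PSnd)))) f A" if f: "f \<in> B" for f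
  proof -
    have ex: "\<exists>i. f \<in> V i" using V(2) f by blast
    then have "f \<in> V (LEAST i. f \<in> V i)" by (rule LeastI_ex)
    then obtain g where "g \<in> A" "\<And>x. Phi (e (LEAST i. f \<in> V i)) f x (g x)"
      using in_A[OF f] unfolding Phi_in_def by blast
    then show ?thesis
      by (intro Phi_inI[of g])
        (simp_all only: Phi_index eval_Comp[OF eval_Tuple[OF eval_Comp[OF p[OF ex] q] eval_id] u])
  qed
  then show ?thesis by blast
qed

text \<open>Supplies a cover together with its pullback at all finite levels: for level 0 the cover
  is made trivial and is its own preimage, otherwise \<open>uniformly_Pi_preimage\<close>
  applies.\<close>

lemma reduc_with_preimages:
  assumes "reduc (enat k) A B"
  obtains V V' e where "uniformly_Pi k V" "uniformly_Pi k V'" "eff (\<lambda>_. e)"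
    "\<And>f. f \<in> B \<Longrightarrow> \<exists>i. f \<in> V i" "\<And>i f. f \<in> B \<Longrightarrow> f \<in> V i \<Longrightarrow> Phi_in (e i) f A"
    "\<And>i a f g. (\<And>x. Phi a f x (g x)) \<Longrightarrow> f \<in> V' (prod_encode (i, a)) \<longleftrightarrow> g \<in> V i"
proof (cases k)
  case 0
  obtain e where "\<forall>f\<in>B. Phi_in e f A"
    using reduc_0D[of A B] assms unfolding 0 zero_enat_def by blast
  then show ?thesis
    by (intro that[of "\<lambda>_. UNIV" "\<lambda>_. UNIV" "\<lambda>_. e"] uniformly_Pi_UNIV eff_const) auto
next
  case (Suc l)
  obtain V e where V: "uniformly_Pi k V" "B \<subseteq> (\<Union>i. V i)" "eff (\<lambda>_. e)"
    "\<And>i f. f \<in> B \<Longrightarrow> f \<in> V i \<Longrightarrow> Phi_in (e i) f A"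
    using assms unfolding reduc_enat_iff by blast
  obtain V' where V': "uniformly_Pi k V'"
    "\<And>i a f g. (\<And>x. Phi a f x (g x)) \<Longrightarrow> f \<in> V' (prod_encode (i, a)) \<longleftrightarrow> g \<in> V i"
    using uniformly_Pi_preimage[OF V(1)[unfolded Suc]] unfolding Suc by (elim exE conjE) simp
  show ?thesis
    by (rule that[OF V(1) V'(1) V(3) _ V(4) V'(2)]) (use V(2) in auto)
qed

lemma computes_trans: "computes f g \<Longrightarrow> computes g h \<Longrightarrow> computes f h"
  unfolding computes_def by (metis index_comp)

lemma reduc_mono:
  assumes "n \<le> m" "reduc n A B" shows "reduc m A B"
proof (cases n)
  case (enat k)
  obtain V e where V: "uniformly_Pi k V" "B \<subseteq> (\<Union>i. V i)" "eff (\<lambda>_. e)"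
    "\<And>i f. f \<in> B \<Longrightarrow> f \<in> V i \<Longrightarrow> Phi_in (e i) f A"
    using assms(2) unfolding enat reduc_enat_iff by blast
  show ?thesis
  proof (cases m)
    case (enat l)
    then have "uniformly_Pi l V"
      using assms(1) V(1) uniformly_Pi_mono[of k l V] by (simp add: \<open>n = enat k\<close>)
    then show ?thesis unfolding enat reduc_enat_iff using V by blast
  next
    case infinity
    show ?thesis
      unfolding infinity reduc_infinity
    proof
      fix f assume "f \<in> B"
      then obtain i where "Phi_in (e i) f A" using V by blast
      then show "\<exists>g\<in>A. computes f g" unfolding Phi_in_def computes_def by blast
    qed
  qed
qed (use assms in auto)

lemma reduc_trans:
  assumes AB: "reduc n A B" and BC: "reduc n B C" shows "reduc n A C"
proof (cases n)
  case (enat k)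
  obtain V V' e where V: "uniformly_Pi k V" "uniformly_Pi k V'" "eff (\<lambda>_. e)"
    "\<And>f. f \<in> B \<Longrightarrow> \<exists>i. f \<in> V i" "\<And>i f. f \<in> B \<Longrightarrow> f \<in> V i \<Longrightarrow> Phi_in (e i) f A"
    "\<And>i a f g. (\<And>x. Phi a f x (g x)) \<Longrightarrow> f \<in> V' (prod_encode (i, a)) \<longleftrightarrow> g \<in> V i"
    using reduc_with_preimages[OF AB[unfolded enat]] by blast
  obtain W d where W: "uniformly_Pi k W" "C \<subseteq> (\<Union>i. W i)" "eff (\<lambda>_. d)"
    "\<And>i f. f \<in> C \<Longrightarrow> f \<in> W i \<Longrightarrow> Phi_in (d i) f B"
    using BC unfolding enat reduc_enat_iff by blast
  obtain c where c: "eff (\<lambda>_. c)" "\<And>e a f g x y. (\<And>x. Phi a f x (g x)) \<Longrightarrow> Phi e g x y \<Longrightarrow>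
      Phi (c (prod_encode (e, a))) f x y"
    using index_comp by blast
  \<comment> \<open>With \<open>n\<close> coding \<open>(i, j)\<close>: \<open>f\<close> lies in
    \<open>W j\<close>, and the function computed from it by \<open>d j\<close> lies in
    \<open>V i\<close>. For \<open>f\<close> in \<open>C\<close> membership in \<open>W j\<close>
    ensures totality, so the pullback is meaningful.\<close>
  let ?X = "\<lambda>n. W (psnd n) \<inter> V' (prod_encode (pfst n, d (psnd n)))"
  let ?e = "\<lambda>n. c (prod_encode (e (pfst n), d (psnd n)))"
  show ?thesis
    unfolding enat
  proof (rule reduc_enatI)
    show "uniformly_Pi k ?X"
    proof (rule uniformly_Pi_Int)
      show "uniformly_Pi k (\<lambda>n. W (psnd n))"
        by (rule uniformly_Pi_reindex[OF W(1)]) (intro eff_intros)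
      show "uniformly_Pi k (\<lambda>n. V' (prod_encode (pfst n, d (psnd n))))"
        by (rule uniformly_Pi_reindex[OF V(2)]) (intro eff_intros eff_comp[OF W(3)])
    qed
    show "eff (\<lambda>_. ?e)"
      by (intro eff_comp[OF c(1)] eff_comp[OF V(3)] eff_comp[OF W(3)] eff_intros)
    show "\<exists>n. f \<in> ?X n" if f: "f \<in> C" for f
    proof -
      obtain j where j: "f \<in> W j" using W(2) f by blast
      then obtain g where g: "g \<in> B" "\<And>x. Phi (d j) f x (g x)"
        using W(4)[OF f] unfolding Phi_in_def by blast
      obtain i where "g \<in> V i" using V(4) g(1) by blast
      then have "f \<in> ?X (prod_encode (i, j))" using j V(6)[OF g(2)] by simp
      then show ?thesis ..
    qed
    show "Phi_in (?e n) f A" if f: "f \<in> C" "f \<in> ?X n" for n f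
    proof -
      obtain g where g: "g \<in> B" "\<And>x. Phi (d (psnd n)) f x (g x)"
        using W(4)[of f "psnd n"] f unfolding Phi_in_def by blast
      then have "g \<in> V (pfst n)" using f(2) V(6)[OF g(2)] by blast
      then obtain h where "h \<in> A" "\<And>x. Phi (e (pfst n)) g x (h x)"
        using V(5) g(1) unfolding Phi_in_def by blast
      then show ?thesis by (intro Phi_inI[of h] c(2)[OF g(2)])
    qed
  qed
next
  case infinity
  then show ?thesis using AB BC computes_trans unfolding infinity reduc_infinity by blast
qed

section \<open>The join as least upper bound\<close>

lemma index_join:
  "\<exists>J. eff (\<lambda>_. J) \<and> (\<forall>e d f g h x. Phi_in e f {g} \<longrightarrow> Phi_in d f {h} \<longrightarrow>
    Phi (J (prod_encode (e, d))) f x (fjoin g h x))"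
proof -
  obtain u where u: "\<And>e f x y. Phi e f x y \<Longrightarrow> eval f u (prod_encode (e, x)) y"
    using universal by blast
  \<comment> \<open>The parity of the argument selects which of the two indices is passed to the
    universal program, and halving gives its input.\<close>
  have "eff (\<lambda>f n. prod_encode (if psnd n = 2 * (psnd n div 2) then pfst (pfst n)
      else psnd (pfst n), psnd n div 2))"
    by (intro eff_intros eff_if dec_intros eff_div) simp_all
  then obtain q where q: "\<And>f n. eval f q n (prod_encode (if psnd n = 2 * (psnd n div 2)
      then pfst (pfst n) else psnd (pfst n), psnd n div 2))"
    unfolding eff_def by blast
  obtain J where J: "eff (\<lambda>_. J)"
    "\<And>n f x y. eval f (Comp u q) (prod_encode (n, x)) y \<Longrightarrow> Phi (J n) f x y"
    using smn[of "Comp u q"] by blast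
  have "Phi (J (prod_encode (e, d))) f x (fjoin g h x)"
    if "Phi_in e f {g}" "Phi_in d f {h}" for e d f g h x
  proof (intro J(2) eval_Comp[OF q] u)
    have even_iff: "x = 2 * (x div 2) \<longleftrightarrow> even x" by presburger
    show "Phi (if psnd (prod_encode (prod_encode (e, d), x)) =
        2 * (psnd (prod_encode (prod_encode (e, d), x)) div 2)
        then pfst (pfst (prod_encode (prod_encode (e, d), x)))
        else psnd (pfst (prod_encode (prod_encode (e, d), x)))) f
       (psnd (prod_encode (prod_encode (e, d), x)) div 2) (fjoin g h x)"
      using that even_iff unfolding fjoin_def Phi_in_def by simp
  qed
  then show ?thesis using J(1) by blast
qed

lemma eff_fjoin_left: "eff (\<lambda>f x. f (2 * x))" and eff_fjoin_right: "eff (\<lambda>f x. f (2 * x + 1))"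
  by (intro eff_intros)+

lemma fjoin_proj [simp]: "(\<lambda>x. fjoin f g (2 * x)) = f" "(\<lambda>x. fjoin f g (2 * x + 1)) = g"
  by (auto simp: fjoin_def)

lemma reduc_mjoin1: "reduc n A (mjoin A B)"
  by (rule reduc_functional[OF eff_fjoin_left]) (auto simp: mjoin_def)

lemma reduc_mjoin2: "reduc n B (mjoin A B)"
  by (rule reduc_functional[OF eff_fjoin_right]) (auto simp: mjoin_def simp del: add_2_eq_Suc' One_nat_def)

text \<open>The common refinement of the two covers makes both reductions available at once, and
  \<open>J\<close> merges their indices effectively.\<close>

lemma reduc_mjoin_least:
  assumes AC: "reduc n A C" and BC: "reduc n B C" shows "reduc n (mjoin A B) C"
proof -
  obtain J where J: "eff (\<lambda>_. J)" "\<And>e d f g h x. Phi_in e f {g} \<Longrightarrow> Phi_in d f {h} \<Longrightarrow>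
    Phi (J (prod_encode (e, d))) f x (fjoin g h x)"
    using index_join by blast
  have J_in: "Phi_in (J (prod_encode (e, d))) f (mjoin A B)"
    if ed: "Phi_in e f A" "Phi_in d f B" for e d f
  proof -
    obtain g h where "g \<in> A" "h \<in> B" "Phi_in e f {g}" "Phi_in d f {h}"
      using ed unfolding Phi_in_def by blast
    then show ?thesis using J(2) by (intro Phi_inI[of "fjoin g h"]) (auto simp: mjoin_def)
  qed
  show ?thesis
  proof (cases n)
    case (enat k)
    obtain V e where V: "uniformly_Pi k V" "C \<subseteq> (\<Union>i. V i)" "eff (\<lambda>_. e)"
      "\<And>i f. f \<in> C \<Longrightarrow> f \<in> V i \<Longrightarrow> Phi_in (e i) f A"
      using AC unfolding enat reduc_enat_iff by blast
    obtain W d where W: "uniformly_Pi k W" "C \<subseteq> (\<Union>i. W i)" "eff (\<lambda>_. d)"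
      "\<And>i f. f \<in> C \<Longrightarrow> f \<in> W i \<Longrightarrow> Phi_in (d i) f B"
      using BC unfolding enat reduc_enat_iff by blast
    show ?thesis
      unfolding enat
    proof (rule reduc_enatI)
      show "uniformly_Pi k (\<lambda>n. V (pfst n) \<inter> W (psnd n))"
        by (intro uniformly_Pi_Int uniformly_Pi_reindex[OF V(1)] uniformly_Pi_reindex[OF W(1)]
            eff_intros)
      show "eff (\<lambda>_ n. J (prod_encode (e (pfst n), d (psnd n))))"
        by (intro eff_comp[OF J(1)] eff_comp[OF V(3)] eff_comp[OF W(3)] eff_intros)
      show "\<exists>n. f \<in> V (pfst n) \<inter> W (psnd n)" if "f \<in> C" for f
      proof -
        obtain i j where "f \<in> V i" "f \<in> W j" using V(2) W(2) \<open>f \<in> C\<close> by blast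
        then show ?thesis by (intro exI[of _ "prod_encode (i, j)"]) simp
      qed
    qed (use V(4) W(4) in \<open>auto intro: J_in\<close>)
  next
    case infinity
    show ?thesis
      unfolding infinity reduc_infinity
    proof
      fix f assume "f \<in> C"
      then obtain e d where "Phi_in e f A" "Phi_in d f B"
        using AC BC unfolding infinity reduc_infinity computes_def Phi_in_def by blast
      then show "\<exists>g\<in>mjoin A B. computes f g"
        using J_in unfolding Phi_in_def computes_def by blast
    qed
  qed
qed

section \<open>The meet as greatest lower bound\<close>

lemma eff_cons: "eff (\<lambda>f. case_nat a f)"
proof -
  have "eff (\<lambda>f x. if x = 0 then a else f (x - 1))"
    by (intro eff_if dec_intros eff_intros)
  then show ?thesis by (rule eff_cong) (simp split: nat.split)
qed

lemma reduc_mmeet1: "reduc n (mmeet A B) A"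
  by (rule reduc_functional[OF eff_cons[of 0]]) (auto simp: mmeet_def)

lemma reduc_mmeet2: "reduc n (mmeet A B) B"
  by (rule reduc_functional[OF eff_cons[of 1]]) (auto simp: mmeet_def)

lemma reduc_mmeet_greatest:
  assumes CA: "reduc n C A" and CB: "reduc n C B" shows "reduc n C (mmeet A B)"
proof -
  obtain t where t: "\<And>f x. Phi t f x (f (Suc x))"
    using eff_index[of "\<lambda>f x. f (Suc x)"] eff_query[OF eff_Suc[OF eff_id]] by blast
  obtain c where c: "eff (\<lambda>_. c)" "\<And>e a f g x y. (\<And>x. Phi a f x (g x)) \<Longrightarrow> Phi e g x y \<Longrightarrow>
      Phi (c (prod_encode (e, a))) f x y"
    using index_comp by blast
  have c_in: "Phi_in (c (prod_encode (e, t))) f C" if "Phi_in e (\<lambda>x. f (Suc x)) C" for e f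
    using that c(2)[of t f, OF t] unfolding Phi_in_def by blast
  show ?thesis
  proof (cases n)
    case (enat k)
    obtain V V' e where V: "uniformly_Pi k V" "uniformly_Pi k V'" "eff (\<lambda>_. e)"
      "\<And>f. f \<in> A \<Longrightarrow> \<exists>i. f \<in> V i" "\<And>i f. f \<in> A \<Longrightarrow> f \<in> V i \<Longrightarrow> Phi_in (e i) f C"
      "\<And>i a f g. (\<And>x. Phi a f x (g x)) \<Longrightarrow> f \<in> V' (prod_encode (i, a)) \<longleftrightarrow> g \<in> V i"
      using reduc_with_preimages[OF CA[unfolded enat]] by blast
    obtain W W' d where W: "uniformly_Pi k W" "uniformly_Pi k W'" "eff (\<lambda>_. d)"
      "\<And>f. f \<in> B \<Longrightarrow> \<exists>i. f \<in> W i" "\<And>i f. f \<in> B \<Longrightarrow> f \<in> W i \<Longrightarrow> Phi_in (d i) f C"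
      "\<And>i a f g. (\<And>x. Phi a f x (g x)) \<Longrightarrow> f \<in> W' (prod_encode (i, a)) \<longleftrightarrow> g \<in> W i"
      using reduc_with_preimages[OF CB[unfolded enat]] by blast
    \<comment> \<open>With \<open>n\<close> coding \<open>(a, i)\<close>: the first value
      \<open>a\<close> tells which problem the tail solves, and the cover is pulled back along the
      shift \<open>t\<close>. Values above 1 do not occur in \<open>mmeet A B\<close> and may be
      treated like 1.\<close>
    let ?X = "\<lambda>n. {f. f 0 = pfst n} \<inter>
      (if pfst n = 0 then V' (prod_encode (psnd n, t)) else W' (prod_encode (psnd n, t)))"
    let ?e = "\<lambda>n. c (prod_encode (if pfst n = 0 then e (psnd n) else d (psnd n), t))"
    have X_iff: "f \<in> ?X (prod_encode (a, i)) \<longleftrightarrow>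
        f 0 = a \<and> (\<lambda>x. f (Suc x)) \<in> (if a = 0 then V i else W i)" for f a i
      using V(6)[of t f, OF t] W(6)[of t f, OF t] by simp
    show ?thesis
      unfolding enat
    proof (rule reduc_enatI)
      \<comment> \<open>\<open>Suc (prod_encode (a, 0))\<close> codes the one-element list
        \<open>[a]\<close>.\<close>
      have "Pi_class 0 (3 * Suc (prod_encode (a, 0))) = {f. f 0 = a}" for a
        unfolding Pi_class_0 by (simp add: nth0_def)
      moreover have "eff (\<lambda>_ n. 3 * Suc (prod_encode (pfst n, 0)))" by (intro eff_intros)
      ultimately have "uniformly_Pi 0 (\<lambda>n. {f. f 0 = pfst n})"
        unfolding uniformly_Pi_iff by blast
      then show "uniformly_Pi k ?X"
        by (intro uniformly_Pi_Int uniformly_Pi_if uniformly_Pi_reindex[OF V(2)]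
            uniformly_Pi_reindex[OF W(2)] eff_intros dec_intros uniformly_Pi_mono[of 0 k]) simp_all
      show "eff (\<lambda>_. ?e)"
        by (intro eff_comp[OF c(1)] eff_if dec_intros eff_comp[OF V(3)] eff_comp[OF W(3)] eff_intros)
      show "\<exists>n. f \<in> ?X n" if f: "f \<in> mmeet A B" for f
      proof -
        obtain a i where "f 0 = a" "(\<lambda>x. f (Suc x)) \<in> (if a = 0 then V i else W i)"
          using f V(4) W(4) unfolding mmeet_def by force
        then show ?thesis using X_iff by blast
      qed
      show "Phi_in (?e n) f C" if f: "f \<in> mmeet A B" "f \<in> ?X n" for n f
      proof -
        obtain a i where n: "n = prod_encode (a, i)" by (metis prod_decode_inverse surj_pair)
        have "f 0 = a" "(\<lambda>x. f (Suc x)) \<in> (if a = 0 then V i else W i)"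
          using f(2) unfolding n X_iff by blast+
        moreover have "(\<lambda>x. f (Suc x)) \<in> (if f 0 = 0 then A else B)"
          using f(1) unfolding mmeet_def by auto
        ultimately have "Phi_in (if a = 0 then e i else d i) (\<lambda>x. f (Suc x)) C"
          using V(5) W(5) by auto
        then show ?thesis unfolding n by (intro c_in) (simp split: if_splits)
      qed
    qed
  next
    case infinity
    show ?thesis
      unfolding infinity reduc_infinity
    proof
      fix f assume "f \<in> mmeet A B"
      then have "(\<lambda>x. f (Suc x)) \<in> A \<or> (\<lambda>x. f (Suc x)) \<in> B" unfolding mmeet_def by auto
      then obtain g where "g \<in> C" "computes (\<lambda>x. f (Suc x)) g"
        using CA CB unfolding infinity reduc_infinity by blast
      moreover have "computes f (\<lambda>x. f (Suc x))" using t unfolding computes_def by blast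
      ultimately show "\<exists>g\<in>C. computes f g" using computes_trans by blast
    qed
  qed
qed

section \<open>Degrees\<close>

lemma mem_deg: "B \<in> deg n A \<longleftrightarrow> reduc n A B \<and> reduc n B A"
  by (simp add: deg_def reduc_equiv_def)

lemma self_mem_deg: "A \<in> deg n A"
  by (simp add: mem_deg reduc_refl)

lemma deg_eq_iff: "deg n A = deg n B \<longleftrightarrow> reduc n A B \<and> reduc n B A"
proof
  assume "deg n A = deg n B"
  then show "reduc n A B \<and> reduc n B A" using self_mem_deg[of B n] by (simp add: mem_deg flip: \<open>deg n A = deg n B\<close>)
next
  assume "reduc n A B \<and> reduc n B A"
  then show "deg n A = deg n B" using reduc_trans by (auto simp: mem_deg set_eq_iff)
qed

lemma degrees_eq: "degrees n = range (deg n)"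
  by (auto simp: degrees_def quotient_def deg_def)

lemma deg_le_iff: "deg_le n (deg n A) (deg n B) \<longleftrightarrow> reduc n A B"
  unfolding deg_le_def using reduc_trans reduc_refl by (meson mem_deg)

lemma mjoin_mono:
  assumes "reduc n A A'" "reduc n B B'" shows "reduc n (mjoin A B) (mjoin A' B')"
  using assms reduc_mjoin1 reduc_mjoin2 reduc_trans by (blast intro: reduc_mjoin_least)

lemma mmeet_mono:
  assumes "reduc n A A'" "reduc n B B'" shows "reduc n (mmeet A B) (mmeet A' B')"
  using assms reduc_mmeet1 reduc_mmeet2 reduc_trans by (blast intro: reduc_mmeet_greatest)

text \<open>Operations on degrees are unions over representatives; by monotonicity all terms agree,
  and degrees are nonempty, so the union is the common value.\<close>

lemma Union_deg_const:
  assumes "\<And>A' B'. A' \<in> deg n A \<Longrightarrow> B' \<in> deg n B \<Longrightarrow> deg n (f A' B') = D"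
  shows "(\<Union>A'\<in>deg n A. \<Union>B'\<in>deg n B. deg n (f A' B')) = D"
proof -
  have "(\<Union>A'\<in>deg n A. \<Union>B'\<in>deg n B. deg n (f A' B')) = (\<Union>A'\<in>deg n A. \<Union>B'\<in>deg n B. D)"
    by (intro SUP_cong refl assms)
  then show ?thesis using self_mem_deg[of A n] self_mem_deg[of B n] by auto
qed

lemma deg_join_deg: "deg_join n (deg n A) (deg n B) = deg n (mjoin A B)"
  unfolding deg_join_def
  by (rule Union_deg_const) (auto simp: deg_eq_iff mem_deg intro: mjoin_mono)

lemma deg_meet_deg: "deg_meet n (deg n A) (deg n B) = deg n (mmeet A B)"
  unfolding deg_meet_def
  by (rule Union_deg_const) (auto simp: deg_eq_iff mem_deg intro: mmeet_mono)

text \<open>Well-definedness: since the reducibilities weaken with the level, each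
  \<open>n\<close>-degree lies within a single \<open>m\<close>-degree.\<close>

lemma deg_map_deg:
  assumes "n \<le> m" shows "deg_map m (deg n A) = deg m A"
proof -
  have "deg m B = deg m A" if "B \<in> deg n A" for B
    using that reduc_mono[OF assms] by (auto simp: deg_eq_iff mem_deg)
  then show ?thesis unfolding deg_map_def using self_mem_deg by blast
qed

section \<open>Failure of preservation of implications\<close>

text \<open>Diagonalisation: \<open>X e\<close> avoids the value, if any, of index \<open>e\<close>
  at argument \<open>e\<close>.\<close>

lemma noncomputable_exists: "\<exists>X. \<not> computable X"
proof -
  define X where "X e = (SOME z. \<forall>y. Phi e (\<lambda>_. 0) e y \<longrightarrow> z \<noteq> y)" for e
  have X: "\<forall>y. Phi e (\<lambda>_. 0) e y \<longrightarrow> X e \<noteq> y" for e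
    unfolding X_def
  proof (rule someI_ex)
    show "\<exists>z. \<forall>y. Phi e (\<lambda>_. 0) e y \<longrightarrow> z \<noteq> y"
    proof (cases "\<exists>y. Phi e (\<lambda>_. 0) e y")
      case True
      then obtain y where "Phi e (\<lambda>_. 0) e y" ..
      then show ?thesis using Phi_det by (intro exI[of _ "Suc y"]) (metis n_not_Suc_n)
    qed auto
  qed
  then have "\<not> computable X"
    unfolding computable_def computes_def by blast
  then show ?thesis by blast
qed

definition finite_variants :: "(nat \<Rightarrow> nat) \<Rightarrow> mass_problem" where
  "finite_variants X = {f. \<exists>n. \<forall>x\<ge>n. f x = X x}"

text \<open>The finitely many deviating values are hardwired. The program depends on
  \<open>f\<close> through \<open>n\<close>, and this nonuniformity is what the counterexample
  exploits.\<close>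

lemma computes_finite_variant:
  assumes "f \<in> finite_variants X" shows "computes f X"
proof -
  obtain n where n: "\<And>x. x \<ge> n \<Longrightarrow> f x = X x"
    using assms unfolding finite_variants_def by blast
  define c where "c = list_encode (map X [0..<n])"
  have "eff (\<lambda>f x. if x < n then nth0 (list_decode c) x else f x)"
    by (intro eff_if dec_intros eff_intros eff_list_intros)
  then obtain e where e: "\<And>f x. Phi e f x (if x < n then nth0 (list_decode c) x else f x)"
    using eff_index by blast
  have "(if x < n then nth0 (list_decode c) x else f x) = X x" for x
    by (simp add: c_def nth0_def n)
  then have "\<forall>x. Phi e f x (X x)" using e[of f] by simp
  then show ?thesis unfolding computes_def by blast
qed

text \<open>Every finite list extends to a finite variant of \<open>X\<close>, so any convergent computation of
  index \<open>e\<close> from a finite oracle outputs the right value, and such a computation can be found by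
  search.\<close>

lemma computable_if_uniform:
  assumes "\<And>f x. f \<in> finite_variants X \<Longrightarrow> Phi e f x (X x)" shows "computable X"
proof -
  \<comment> \<open>Here \<open>n\<close> codes \<open>(y, (c, s))\<close>: the derivation
    \<open>c\<close> yields output \<open>y\<close> from the finite oracle \<open>s\<close>.\<close>
  define R where "R x n \<longleftrightarrow> valid (list_decode (pfst (psnd n))) \<and>
    agrees_fin (list_decode (psnd (psnd n))) (list_decode (pfst (psnd n))) \<and>
    jd e x (pfst n) \<in> set (list_decode (pfst (psnd n)))" for x n
  have dec_R: "dec (\<lambda>f z. R (pfst z) (psnd z))"
    unfolding R_def by (intro dec_intros dec_valid dec_agrees_fin dec_mem_jd eff_intros)
  have R_ex: "\<exists>n. R x n" for x
  proof -
    have "X \<in> finite_variants X" unfolding finite_variants_def by blast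
    then obtain c where c: "derives X (list_decode c) e x (X x)"
      using assms normal_form by blast
    then obtain m where "agrees_fin (map X [0..<m]) (list_decode c)"
      using agrees_imp_agrees_fin by (auto simp: derives_def)
    then show ?thesis
      using c by (intro exI[of _ "prod_encode (X x, prod_encode (c, list_encode (map X [0..<m])))"])
        (simp add: R_def derives_def)
  qed
  have R_correct: "pfst n = X x" if "R x n" for x n
  proof -
    let ?s = "list_decode (psnd (psnd n))"
    let ?f = "\<lambda>i. if i < length ?s then nth0 ?s i else X i"
    have "derives ?f (list_decode (pfst (psnd n))) e x (pfst n)"
      using that unfolding R_def derives_def by (auto intro: agrees_fin_imp_agrees)
    then have "Phi e ?f x (pfst n)" using normal_form by blast
    moreover have "?f \<in> finite_variants X"
      unfolding finite_variants_def by (auto intro: exI[of _ "length ?s"])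
    ultimately show ?thesis using assms Phi_det by blast
  qed
  have "eff (\<lambda>f x. pfst (LEAST n. R x n))"
    by (intro eff_intros eff_Least dec_R R_ex)
  moreover have "pfst (LEAST n. R x n) = X x" for x
    by (rule R_correct[OF LeastI_ex[OF R_ex]])
  ultimately show ?thesis unfolding computable_iff_eff by simp
qed

text \<open>The usual representative of implication in the Medvedev lattice: \<open>h 0\<close> is
  the index of a functional, and the rest of \<open>h\<close> is its additional oracle.\<close>

definition medvedev_imp :: "mass_problem \<Rightarrow> mass_problem \<Rightarrow> mass_problem" where
  "medvedev_imp A B = {h. \<forall>g\<in>A. Phi_in (h 0) (fjoin g (\<lambda>x. h (Suc x))) B}"

lemma reduc_medvedev_imp: "reduc 0 B (mjoin A (medvedev_imp A B))"
proof -
  \<comment> \<open>In \<open>k = fjoin g h\<close> the index \<open>h 0\<close> sits at place 1;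
    shifting the odd places by 2 removes it from the oracle.\<close>
  define F where "F k x = (if x = 2 * (x div 2) then k x else k (x + 2))"
    for k :: "nat \<Rightarrow> nat" and x :: nat
  have "eff F"
    unfolding F_def by (intro eff_if dec_intros eff_intros eff_div) simp
  then obtain r where r: "\<And>k x. eval k r x (F k x)" unfolding eff_def by blast
  have F: "F (fjoin g h) = fjoin g (\<lambda>x. h (Suc x))" for g h
  proof
    fix x :: nat
    have "x = 2 * (x div 2) \<longleftrightarrow> even x" by presburger
    then show "F (fjoin g h) x = fjoin g (\<lambda>x. h (Suc x)) x" by (simp add: F_def fjoin_def)
  qed
  obtain u where u: "\<And>e f x y. Phi e f x y \<Longrightarrow> eval f u (prod_encode (e, x)) y"
    using universal by blast
  show ?thesis
  proof (rule reduc_single)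
    fix k assume "k \<in> mjoin A (medvedev_imp A B)"
    then obtain g h where k: "k = fjoin g h" "g \<in> A" "h \<in> medvedev_imp A B"
      unfolding mjoin_def by blast
    then obtain y where y: "y \<in> B" "\<And>x. Phi (h 0) (F k) x (y x)"
      unfolding medvedev_imp_def Phi_in_def k(1) F by blast
    have "eval k (psub r u) (prod_encode (h 0, x)) (y x)" for x
      by (rule eval_psub[OF r u[OF y(2)]])
    moreover have "k 1 = h 0" by (simp add: k(1) fjoin_def)
    then have "eval k (Comp Query (const_prog 1)) x (h 0)" for x
      using eval_Comp[OF eval_const[of k 1 x] eval_Query] by simp
    ultimately show
      "Phi_in (prog_index (Comp (psub r u) (Tuple (Comp Query (const_prog 1)) (Tuple PFst PSnd)))) k B"
      by (intro Phi_inI[OF y(1)]) (simp only: Phi_index, blast intro: eval_Comp eval_Tuple eval_id)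
  qed
qed

text \<open>Residuation at level 0. From left to right, the single index supplied by
  \<open>reduc_0D\<close> is prefixed to the elements of \<open>C\<close>.\<close>

lemma reduc_medvedev_imp_iff: "reduc 0 B (mjoin A C) \<longleftrightarrow> reduc 0 (medvedev_imp A B) C"
proof
  assume "reduc 0 B (mjoin A C)"
  then obtain e where e: "\<forall>f\<in>mjoin A C. Phi_in e f B" using reduc_0D by blast
  show "reduc 0 (medvedev_imp A B) C"
    by (rule reduc_functional[OF eff_cons[of e]]) (use e in \<open>auto simp: medvedev_imp_def mjoin_def\<close>)
next
  assume "reduc 0 (medvedev_imp A B) C"
  then show "reduc 0 B (mjoin A C)"
    using reduc_trans[OF reduc_medvedev_imp mjoin_mono[OF reduc_refl]] by blast
qed

lemma is_deg_imp_iff: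
  "is_deg_imp n (deg n A) (deg n B) (deg n C) \<longleftrightarrow> (\<forall>X. reduc n B (mjoin A X) \<longleftrightarrow> reduc n C X)"
  by (simp add: is_deg_imp_def degrees_eq deg_join_deg deg_le_iff)

text \<open>A computable \<open>h\<close> can be built into a program, which leaves one functional
  that works for all of \<open>A\<close> without additional oracle.\<close>

lemma reduc_if_computable_medvedev_imp:
  assumes "h \<in> medvedev_imp A B" "computable h" shows "\<exists>e. \<forall>f\<in>A. Phi_in e f B"
proof -
  have h: "eff (\<lambda>_. h)" using assms(2) computable_iff_eff by blast
  have "eff (\<lambda>f x. if x = 2 * (x div 2) then f (x div 2) else h (Suc (x div 2)))"
    by (intro eff_if dec_intros eff_intros eff_comp[OF h] eff_div) simp_all
  then obtain a where
    a: "\<And>f x. Phi a f x (if x = 2 * (x div 2) then f (x div 2) else h (Suc (x div 2)))"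
    using eff_index by blast
  have "x = 2 * (x div 2) \<longleftrightarrow> even x" for x :: nat by presburger
  then have a': "Phi a f x (fjoin f (\<lambda>x. h (Suc x)) x)" for f x
    using a[of f x] by (simp add: fjoin_def)
  obtain c where c: "eff (\<lambda>_. c)" "\<And>e a f g x y. (\<And>x. Phi a f x (g x)) \<Longrightarrow> Phi e g x y \<Longrightarrow>
      Phi (c (prod_encode (e, a))) f x y"
    using index_comp by blast
  have "Phi_in (c (prod_encode (h 0, a))) f B" if f: "f \<in> A" for f
  proof -
    obtain y where "y \<in> B" "\<And>x. Phi (h 0) (fjoin f (\<lambda>x. h (Suc x))) x (y x)"
      using assms(1) f unfolding medvedev_imp_def Phi_in_def by blast
    then show ?thesis by (intro Phi_inI[of y] c(2)[OF a'])
  qed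
  then show ?thesis by blast
qed

lemma imp_not_preserved:
  "\<exists>a \<in> degrees 0. \<exists>b \<in> degrees 0. \<exists>c d. is_deg_imp 0 a b c \<and>
     is_deg_imp \<infinity> (deg_map \<infinity> a) (deg_map \<infinity> b) d \<and> deg_map \<infinity> c \<noteq> d"
proof -
  obtain X where X: "\<not> computable X" using noncomputable_exists by blast
  let ?A = "finite_variants X" and ?B = "{X}"
  let ?C = "medvedev_imp ?A ?B"
  have BA: "reduc \<infinity> ?B ?A"
    unfolding reduc_infinity using computes_finite_variant by simp
  have "is_deg_imp 0 (deg 0 ?A) (deg 0 ?B) (deg 0 ?C)"
    unfolding is_deg_imp_iff using reduc_medvedev_imp_iff by blast
  moreover have "is_deg_imp \<infinity> (deg \<infinity> ?A) (deg \<infinity> ?B) (deg \<infinity> UNIV)"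
  proof -
    have "reduc \<infinity> ?B (mjoin ?A Y)" for Y by (rule reduc_trans[OF BA reduc_mjoin1])
    moreover have "reduc \<infinity> UNIV Y" for Y :: mass_problem
      by (rule reduc_functional[OF eff_id]) simp
    ultimately show ?thesis unfolding is_deg_imp_iff by simp
  qed
  moreover have "deg \<infinity> ?C \<noteq> deg \<infinity> UNIV"
  proof
    assume "deg \<infinity> ?C = deg \<infinity> UNIV"
    then have "reduc \<infinity> ?C UNIV" by (simp add: deg_eq_iff)
    \<comment> \<open>The reduction is applied to the zero function, an element of
      \<open>UNIV\<close>.\<close>
    then obtain h where "h \<in> ?C" "computable h"
      unfolding reduc_infinity computable_def by blast
    then obtain e where "\<forall>f\<in>?A. Phi_in e f ?B"
      using reduc_if_computable_medvedev_imp by blast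
    then have "computable X"
      by (intro computable_if_uniform[of X e]) (auto simp: Phi_in_def)
    then show False using X by blast
  qed
  ultimately show ?thesis
    unfolding degrees_eq
    by (intro bexI[of _ "deg 0 ?A"] bexI[of _ "deg 0 ?B"] exI[of _ "deg 0 ?C"]
        exI[of _ "deg \<infinity> UNIV"] conjI rangeI) (simp_all add: deg_map_deg)
qed

theorem proposition3p1:
  "(\<forall>n m :: enat. n \<le> m \<longrightarrow>
      (\<forall>A. deg_map m (deg n A) = deg m A) \<and>
      deg_map m ` degrees n = degrees m \<and>
      deg_map m (deg_zero n) = deg_zero m \<and>
      deg_map m (deg_one n) = deg_one m \<and>
      (\<forall>a \<in> degrees n. \<forall>b \<in> degrees n.
         deg_map m (deg_join n a b) = deg_join m (deg_map m a) (deg_map m b) \<and>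
         deg_map m (deg_meet n a b) = deg_meet m (deg_map m a) (deg_map m b))) \<and>
   (\<exists>n m :: enat. n \<le> m \<and>
      (\<exists>a \<in> degrees n. \<exists>b \<in> degrees n. \<exists>c d.
         is_deg_imp n a b c \<and>
         is_deg_imp m (deg_map m a) (deg_map m b) d \<and>
         deg_map m c \<noteq> d))"
proof (intro conjI allI impI)
  show "\<exists>n m :: enat. n \<le> m \<and>
      (\<exists>a \<in> degrees n. \<exists>b \<in> degrees n. \<exists>c d.
         is_deg_imp n a b c \<and>
         is_deg_imp m (deg_map m a) (deg_map m b) d \<and>
         deg_map m c \<noteq> d)"
    by (intro exI[of _ 0] exI[of _ \<infinity>] conjI imp_not_preserved) simp
qed (auto simp: deg_map_deg degrees_eq image_image deg_zero_def deg_one_def deg_join_deg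
      deg_meet_deg)

end
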